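(* Let $G$ be a signed multidigraph, $v$ a vertex of $G$, $\gamma_d=\gamma_{\mathcal P}(d(G,v))$, $\gamma_v=\gamma_{\mathcal P}(G- v)$, and let $\lambda=0$ if $\gamma_v=\gamma_d$ and $\lambda=1$ otherwise. If $\gamma_{\mathcal P}(G) \geq 2$, then $0\leq \gamma_d-\gamma_v\leq 2$ and \[ I_{\gamma_d+k}(d^{k+\lambda+i}(G,v),X)= \left\langle \bigcup_{l=0}^{k} P_{l}^{k+\lambda+i}(v) \cdot I_{\gamma_d+k-l}(G, X)|_{x_v=0} \right\rangle \] for all $k\geq 1$ and $i\geq 0$.
   Context: $\mathcal{P}$ is a principal ideal domain. A signed multidigraph $G$ is a finite multidigraph with signs $\pm1$ on its arcs; for distinct vertices $u,w$, $m_{uw}$ is the number of arcs from $u$ to $w$ and $\sigma(uw)$ their sign. With one variable $x_u$ per vertex, the generalized Laplacian $L(G,X)$ has diagonal entries $x_u$ and off-diagonal entries $-\sigma(uw)m_{uw}1_{\mathcal P}$. The critical ideal $I_i(G,X)$ is the ideal of $\mathcal P[X]$ generated by the $i\times i$ minors of $L(G,X)$, with $I_i(G,X)=\langle0\rangle$ for $i>|V(G)|$; the algebraic co-rank $\gamma_{\mathcal P}(G)$ is the largest $i$ with $I_i(G,X)=\langle 1\rangle$. $d^k(G,v)$ is obtained by duplicating $v$ $k$ times: new vertices $v^1,\dots,v^k$ ($v^0=v$), each having exactly the arcs of $v$ (multiplicities, signs, both directions) to every vertex of $G-v$, and no arcs among $v^0,\dots,v^k$; the variable of $v^i$ is $x_{v^i}$;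 $d(G,v)=d^1(G,v)$. $P^k_l(v)=\{\prod_{c\in C}x_{v^c}: C\subseteq\{0,\dots,k\}, |C|=l\}$, $P^k_0(v)=\{1\}$; $A\cdot B=\{ab:a\in A,b\in B\}$. $I|_{x_v=0}$ is the ideal generated by the images under $x_v\mapsto 0$, viewed in the larger polynomial ring. *)

theory Defs
  imports
    "HOL-Library.Poly_Mapping"
    "HOL-Algebra.Coset"
    "HOL-Algebra.Ring_Divisibility"
    "HOL-Algebra.Algebraic_Closure_Type"
    "Jordan_Normal_Form.Determinant"
    "Graph_Theory.Digraph"
begin

section \<open>Multivariate polynomials\<close>

text \<open>Monomials are finitely supported exponent functions, so \<open>('v, 'a) mpol\<close> is the ring of
  polynomials over \<open>'a\<close> in one variable for each element of \<open>'v\<close>; a vertex set \<open>V\<close> cuts out the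
  subring \<open>mpol_ring V\<close> of polynomials in the variables indexed by \<open>V\<close> only.\<close>

type_synonym ('v, 'a) mpol = "('v \<Rightarrow>\<^sub>0 nat) \<Rightarrow>\<^sub>0 'a"

definition mvar :: "'v \<Rightarrow> ('v, 'a::comm_ring_1) mpol" where
  "mvar u = Poly_Mapping.single (Poly_Mapping.single u 1) 1"

definition mpol_ring :: "'v set \<Rightarrow> ('v, 'a::comm_ring_1) mpol ring" where
  "mpol_ring V = ring_of_type_algebra
     \<lparr>carrier := {p. \<forall>m\<in>Poly_Mapping.keys p. Poly_Mapping.keys m \<subseteq> V}\<rparr>"

text \<open>The ring homomorphism over \<open>'a\<close> that sends the variable of \<open>u\<close> to \<open>f u\<close>.\<close>

definition mpol_subst ::
    "('v \<Rightarrow> ('w, 'a) mpol) \<Rightarrow> ('v, 'a) mpol \<Rightarrow> ('w, 'a::comm_ring_1) mpol" where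
  "mpol_subst f p = (\<Sum>m\<in>Poly_Mapping.keys p.
     Poly_Mapping.single 0 (Poly_Mapping.lookup p m) *
       (\<Prod>u\<in>Poly_Mapping.keys m. f u ^ Poly_Mapping.lookup m u))"


section \<open>Signed multidigraphs and generalized Laplacians\<close>

text \<open>Parallel arcs between distinct vertices share their sign, so that \<open>\<sigma>(uw)\<close> makes sense.
  Loops are allowed, but play no role in the Laplacian.\<close>

locale signed_multidigraph = fin_digraph G
  for G :: "('v, 'e) pre_digraph" (structure) +
  fixes \<sigma> :: "'e \<Rightarrow> int"
  assumes sign_values: "e \<in> arcs G \<Longrightarrow> \<sigma> e \<in> {1, -1}"
    and sign_parallel: "\<lbrakk>e \<in> arcs G; e' \<in> arcs G; arc_to_ends G e = arc_to_ends G e';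
      tail G e \<noteq> head G e\<rbrakk> \<Longrightarrow> \<sigma> e = \<sigma> e'"

definition arcs_from_to :: "('v, 'e) pre_digraph \<Rightarrow> 'v \<Rightarrow> 'v \<Rightarrow> 'e set" where
  "arcs_from_to G u w = {e \<in> arcs G. tail G e = u \<and> head G e = w}"

definition arc_mult :: "('v, 'e) pre_digraph \<Rightarrow> 'v \<Rightarrow> 'v \<Rightarrow> nat" where
  "arc_mult G u w = card (arcs_from_to G u w)"

text \<open>The common sign of the arcs from \<open>u\<close> to \<open>w\<close>; unspecified if there are none, in which case
  it only ever gets multiplied by the multiplicity \<open>0\<close>.\<close>

definition pair_sign :: "('v, 'e) pre_digraph \<Rightarrow> ('e \<Rightarrow> int) \<Rightarrow> 'v \<Rightarrow> 'v \<Rightarrow> int" where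
  "pair_sign G \<sigma> u w = the_elem (\<sigma> ` arcs_from_to G u w)"

definition gen_laplacian ::
    "('v, 'e) pre_digraph \<Rightarrow> ('e \<Rightarrow> int) \<Rightarrow> 'v \<Rightarrow> 'v \<Rightarrow> ('v, 'a::comm_ring_1) mpol" where
  "gen_laplacian G \<sigma> u w =
     (if u = w then mvar u else - of_int (pair_sign G \<sigma> u w) * of_nat (arc_mult G u w))"


section \<open>Critical ideals and the algebraic co-rank\<close>

text \<open>The \<open>i \<times> i\<close> minors of a matrix indexed by \<open>V\<close>. As \<open>V\<close> carries no order, the selected rows
  and columns are enumerated in every possible way; reordering only changes the sign of a minor,
  so the ideal generated is not affected. There is no minor of size \<open>i > card V\<close>, and the only
  one of size \<open>0\<close> is \<open>1\<close>.\<close>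

definition minors :: "'v set \<Rightarrow> ('v \<Rightarrow> 'v \<Rightarrow> 'b::comm_ring_1) \<Rightarrow> nat \<Rightarrow> 'b set" where
  "minors V A i = {det (mat i i (\<lambda>(a, b). A (rs ! a) (cs ! b))) | rs cs.
     distinct rs \<and> distinct cs \<and> length rs = i \<and> length cs = i \<and> set rs \<subseteq> V \<and> set cs \<subseteq> V}"

text \<open>For \<open>i > card (verts G)\<close> this is the ideal generated by the empty set, the zero ideal.\<close>

definition critical_ideal ::
    "('v, 'e) pre_digraph \<Rightarrow> ('e \<Rightarrow> int) \<Rightarrow> nat \<Rightarrow> ('v, 'a::comm_ring_1) mpol set" where
  "critical_ideal G \<sigma> i = Idl\<^bsub>mpol_ring (verts G)\<^esub> (minors (verts G) (gen_laplacian G \<sigma>) i)"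

definition algebraic_corank ::
    "'a::comm_ring_1 itself \<Rightarrow> ('v, 'e) pre_digraph \<Rightarrow> ('e \<Rightarrow> int) \<Rightarrow> nat" where
  "algebraic_corank _ G \<sigma> =
     Max {i. (critical_ideal G \<sigma> i :: ('v, 'a) mpol set) = Idl\<^bsub>mpol_ring (verts G)\<^esub> {1}}"


section \<open>Duplication of a vertex\<close>

text \<open>\<open>(u, 0)\<close> is the vertex \<open>u\<close> of \<open>G\<close>, and \<open>(v, c)\<close> is the copy \<open>v\<^sup>c\<close> of \<open>v\<close>. The arc \<open>(e, 0)\<close> is
  the arc \<open>e\<close> of \<open>G\<close>, and for an arc \<open>e\<close> with exactly one end in \<open>v\<close>, \<open>(e, c)\<close> is the
  corresponding arc at \<open>v\<^sup>c\<close>. Loops at \<open>v\<close> are discarded, since there are to be no arcs among the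
  copies of \<open>v\<close>. If \<open>\<sigma>\<close> is the sign of \<open>G\<close>, then \<open>\<sigma> \<circ> fst\<close> is the one of \<open>duplicate k G v\<close>.\<close>

definition duplicate ::
    "nat \<Rightarrow> ('v, 'e) pre_digraph \<Rightarrow> 'v \<Rightarrow> ('v \<times> nat, 'e \<times> nat) pre_digraph" where
  "duplicate k G v =
     \<lparr> verts = (\<lambda>u. (u, 0)) ` verts G \<union> (\<lambda>c. (v, c)) ` {1..k},
       arcs = {(e, c). e \<in> arcs G \<and> \<not> (tail G e = v \<and> head G e = v) \<and>
                 (c = 0 \<or> c \<in> {1..k} \<and> (tail G e = v \<or> head G e = v))},
       tail = (\<lambda>(e, c). (tail G e, if tail G e = v then c else 0)),
       head = (\<lambda>(e, c). (head G e, if head G e = v then c else 0)) \<rparr>"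

definition copy_products :: "'v \<Rightarrow> nat \<Rightarrow> nat \<Rightarrow> ('v \<times> nat, 'a::comm_ring_1) mpol set" where
  "copy_products v k l = {\<Prod>c\<in>C. mvar (v, c) | C. C \<subseteq> {0..k} \<and> card C = l}"

text \<open>The ideal \<open>I|\<^bsub>x\<^sub>v=0\<^esub>\<close>, for an ideal \<open>I\<close> of polynomials in the variables of \<open>G\<close>, viewed in the
  polynomial ring in the variables of \<open>duplicate k G v\<close>.\<close>

definition ideal_at_zero ::
    "nat \<Rightarrow> ('v, 'e) pre_digraph \<Rightarrow> 'v \<Rightarrow> ('v, 'a::comm_ring_1) mpol set
      \<Rightarrow> ('v \<times> nat, 'a) mpol set" where
  "ideal_at_zero k G v I = Idl\<^bsub>mpol_ring (verts (duplicate k G v))\<^esub>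
     (mpol_subst (\<lambda>u. if u = v then 0 else mvar (u, 0)) ` I)"

end

theory Submission
  imports Defs
begin

text \<open>
  Setting the diagonal entry \<open>x\<^sub>c\<close> of a copy \<open>v\<^sup>c\<close> to zero splits a minor that contains this entry into
  a minor with \<open>x\<^sub>c = 0\<close> and \<open>x\<^sub>c\<close> times a smaller minor. Doing this for all copies, only those minors
  survive that have at most one row and one column of a copy, as two copies now give equal rows; the
  survivors are minors of \<open>L(G, X)\<close> at \<open>x\<^sub>v = 0\<close>. So every minor of a duplication lies in the ideal
  generated by products of copy variables and such minors. The products with more than \<open>k\<close> variables
  are redundant, since \<open>I\<^sub>g(G, X)\<close> with \<open>g = \<gamma>\<^sub>d\<close> becomes trivial at \<open>x\<^sub>v = 0\<close>: set both copy variables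
  to zero in \<open>I\<^sub>g(d(G, v), X) = \<langle>1\<rangle>\<close>.

  Conversely, let \<open>R\<close>, \<open>C\<close> be rows and columns without the copy \<open>s\<close>. If a copy \<open>r\<close> occurs in \<open>R\<close> but
  not in \<open>C\<close>, then the minor of \<open>sR\<close>, \<open>sC\<close> is \<open>x\<^sub>s\<close> times that of \<open>R\<close>, \<open>C\<close>. If a copy \<open>t\<close> occurs in
  neither, then \<open>x\<^sub>s\<close> times the minor of \<open>R\<close>, \<open>C\<close> is the difference of those of \<open>sR\<close>, \<open>sC\<close> and
  \<open>sR\<close>, \<open>tC\<close>. A spare copy is missing only for \<open>l = k = m\<close>, where \<open>\<lambda> = 0\<close>; there \<open>\<gamma>\<^sub>v = \<gamma>\<^sub>d\<close>, so that
  minors of \<open>G - v\<close> suffice. Finally, expanding a minor of \<open>L(G, X)\<close> along the row and the column of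
  \<open>v\<close> yields \<open>\<gamma>\<^sub>d \<le> \<gamma>\<^sub>v + 2\<close>.
\<close>


section \<open>Minors indexed by lists\<close>

text \<open>The counterpart of \<open>mat_delete\<close> on index lists: deleting a row or a column
  of a submatrix shortens the list that enumerates it.\<close>

definition skip :: "nat \<Rightarrow> 'a list \<Rightarrow> 'a list" where
  "skip i xs = take i xs @ drop (Suc i) xs"

lemma length_skip [simp]: "i < length xs \<Longrightarrow> length (skip i xs) = length xs - 1"
  by (simp add: skip_def)

lemma nth_skip:
  "\<lbrakk>i < length xs; a < length xs - 1\<rbrakk> \<Longrightarrow> skip i xs ! a = xs ! (if a < i then a else Suc a)"
  by (auto simp: skip_def nth_append)

lemma skip_0_Cons [simp]: "skip 0 (x # xs) = xs"
  by (simp add: skip_def)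

lemma distinct_skip: "distinct xs \<Longrightarrow> i < length xs \<Longrightarrow> distinct (skip i xs)"
  and set_skip: "distinct xs \<Longrightarrow> i < length xs \<Longrightarrow> set (skip i xs) = set xs - {xs ! i}"
proof -
  assume *: "distinct xs" "i < length xs"
  obtain ys x zs where xs: "xs = ys @ x # zs" and i: "i = length ys"
    using id_take_nth_drop[OF *(2)] *(2) by (metis length_take min.absorb4)
  show "distinct (skip i xs)" "set (skip i xs) = set xs - {xs ! i}"
    using *(1) by (auto simp: skip_def xs i)
qed

text \<open>The size is read off from \<open>rs\<close>; that \<open>cs\<close> has the same length
  is a side condition wherever it matters. Separate index types for rows and columns keep
  transposition unrestricted.\<close>

definition list_minor :: "('v \<Rightarrow> 'w \<Rightarrow> 'b::comm_ring_1) \<Rightarrow> 'v list \<Rightarrow> 'w list \<Rightarrow> 'b" where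
  "list_minor A rs cs = det (mat (length rs) (length rs) (\<lambda>(a, b). A (rs ! a) (cs ! b)))"

lemma minors_iff:
  "\<mu> \<in> minors V A i \<longleftrightarrow> (\<exists>rs cs. \<mu> = list_minor A rs cs \<and> distinct rs \<and> distinct cs \<and>
     length rs = i \<and> length cs = i \<and> set rs \<subseteq> V \<and> set cs \<subseteq> V)"
  unfolding minors_def list_minor_def by auto

lemma minorsI:
  assumes "distinct rs" "distinct cs" "length rs = i" "length cs = i" "set rs \<subseteq> V" "set cs \<subseteq> V"
  shows "list_minor A rs cs \<in> minors V A i"
  using assms by (auto simp: minors_iff)

lemma minorsE:
  assumes "\<mu> \<in> minors V A i"
  obtains rs cs where "\<mu> = list_minor A rs cs" "distinct rs" "distinct cs"
    "length rs = i" "length cs = i" "set rs \<subseteq> V" "set cs \<subseteq> V"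
  using assms by (auto simp: minors_iff)

lemma list_minor_cong:
  assumes "length rs = length rs'"
    and "\<And>a b. a < length rs \<Longrightarrow> b < length rs \<Longrightarrow> A (rs ! a) (cs ! b) = B (rs' ! a) (cs' ! b)"
  shows "list_minor A rs cs = list_minor B rs' cs'"
  unfolding list_minor_def using assms by (auto intro!: arg_cong[where f = det] cong_mat)

lemma list_minor_cong_set:
  assumes "length cs = length rs"
    and "\<And>r c. r \<in> set rs \<Longrightarrow> c \<in> set cs \<Longrightarrow> A r c = B r c"
  shows "list_minor A rs cs = list_minor B rs cs"
  by (rule list_minor_cong) (use assms in auto)

lemma list_minor_map:
  assumes "length cs = length rs"
  shows "list_minor A (map f rs) (map g cs) = list_minor (\<lambda>r c. A (f r) (g c)) rs cs"
  by (rule list_minor_cong) (use assms in auto)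

lemma minors_cong:
  assumes "\<And>r c. r \<in> V \<Longrightarrow> c \<in> V \<Longrightarrow> A r c = B r c"
  shows "minors V A i = minors V B i"
proof -
  have "minors V A i \<subseteq> minors V B i" if "\<And>r c. r \<in> V \<Longrightarrow> c \<in> V \<Longrightarrow> A r c = B r c"
    for A B :: "'a \<Rightarrow> 'a \<Rightarrow> 'b"
  proof
    fix \<mu> assume "\<mu> \<in> minors V A i"
    then obtain rs cs where *: "\<mu> = list_minor A rs cs" "distinct rs" "distinct cs"
      "length rs = i" "length cs = i" "set rs \<subseteq> V" "set cs \<subseteq> V"
      by (auto simp: minors_iff)
    have "\<mu> = list_minor B rs cs"
      unfolding *(1) by (rule list_minor_cong_set) (use * that in auto)
    then show "\<mu> \<in> minors V B i" using minorsI[OF *(2-7), of B] by simp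
  qed
  from this[of A B] this[of B A] assms show ?thesis by auto
qed

lemma (in comm_ring_hom) hom_list_minor:
  "hom (list_minor A rs cs) = list_minor (\<lambda>r c. hom (A r c)) rs cs"
proof -
  have "map_mat hom (mat (length rs) (length rs) (\<lambda>(a, b). A (rs ! a) (cs ! b))) =
      mat (length rs) (length rs) (\<lambda>(a, b). hom (A (rs ! a) (cs ! b)))"
    by (rule eq_matI) auto
  then show ?thesis unfolding list_minor_def hom_det[symmetric] by simp
qed

lemma (in comm_ring_hom) hom_minors:
  "hom ` minors V A i = minors V (\<lambda>r c. hom (A r c)) i"
proof (intro equalityI subsetI)
  fix \<mu> assume "\<mu> \<in> hom ` minors V A i"
  then show "\<mu> \<in> minors V (\<lambda>r c. hom (A r c)) i"
    by (auto elim!: minorsE simp: hom_list_minor intro!: minorsI)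
next
  fix \<mu> assume "\<mu> \<in> minors V (\<lambda>r c. hom (A r c)) i"
  then show "\<mu> \<in> hom ` minors V A i"
    by (auto elim!: minorsE simp: hom_list_minor[symmetric] intro!: imageI minorsI)
qed

section \<open>Transposition, repeated lines and Laplace expansion\<close>

lemma list_minor_transpose:
  assumes "length cs = length rs"
  shows "list_minor A rs cs = list_minor (\<lambda>c r. A r c) cs rs"
proof -
  have "transpose_mat (mat (length rs) (length rs) (\<lambda>(a, b). A (rs ! a) (cs ! b)))
      = mat (length cs) (length cs) (\<lambda>(a, b). A (rs ! b) (cs ! a))"
    using assms by (intro eq_matI) auto
  then show ?thesis
    unfolding list_minor_def by (metis det_transpose mat_carrier)
qed

lemma list_minor_identical_rows:
  assumes "i < length rs" "j < length rs" "i \<noteq> j" "length cs = length rs"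
    and "\<And>c. c \<in> set cs \<Longrightarrow> A (rs ! i) c = A (rs ! j) c"
  shows "list_minor A rs cs = 0"
  unfolding list_minor_def
  by (rule det_identical_rows[OF mat_carrier assms(3,1,2)]) (use assms in \<open>auto simp: row_mat\<close>)

lemma list_minor_identical_cols:
  assumes "i < length cs" "j < length cs" "i \<noteq> j" "length cs = length rs"
    and "\<And>r. r \<in> set rs \<Longrightarrow> A r (cs ! i) = A r (cs ! j)"
  shows "list_minor A rs cs = 0"
  unfolding list_minor_transpose[OF assms(4)]
  by (rule list_minor_identical_rows[of i _ j]) (use assms in auto)

lemma cofactor_list_minor:
  assumes "length cs = length rs" "i < length rs" "j < length rs"
  shows "cofactor (mat (length rs) (length rs) (\<lambda>(a, b). A (rs ! a) (cs ! b))) i j =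
    (-1) ^ (i + j) * list_minor A (skip i rs) (skip j cs)"
proof -
  have "mat_delete (mat (length rs) (length rs) (\<lambda>(a, b). A (rs ! a) (cs ! b))) i j =
     mat (length rs - 1) (length rs - 1) (\<lambda>(a, b). A (skip i rs ! a) (skip j cs ! b))"
    using assms by (intro eq_matI) (auto simp: mat_delete_def nth_skip)
  then show ?thesis using assms by (simp add: cofactor_def list_minor_def)
qed

lemma list_minor_expand_row:
  assumes "length cs = length rs" "i < length rs"
  shows "list_minor A rs cs =
    (\<Sum>j<length rs. A (rs ! i) (cs ! j) * ((-1) ^ (i + j) * list_minor A (skip i rs) (skip j cs)))"
proof -
  have "list_minor A rs cs = (\<Sum>j<length rs.
      mat (length rs) (length rs) (\<lambda>(a, b). A (rs ! a) (cs ! b)) $$ (i, j) *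
      cofactor (mat (length rs) (length rs) (\<lambda>(a, b). A (rs ! a) (cs ! b))) i j)"
    unfolding list_minor_def by (rule laplace_expansion_row) (use assms in auto)
  also have "\<dots> = (\<Sum>j<length rs. A (rs ! i) (cs ! j) *
      ((-1) ^ (i + j) * list_minor A (skip i rs) (skip j cs)))"
    using assms by (intro sum.cong) (auto simp: cofactor_list_minor)
  finally show ?thesis .
qed

text \<open>A determinant is affine in each single entry. In the expansion along row
  \<open>rs ! i\<close>, all cofactors agree for \<open>A\<close> and \<open>B\<close>, because that
  row is deleted and occurs only once; so only the summand of column \<open>cs ! j\<close>
  differs.\<close>

lemma list_minor_change_entry:
  assumes "length cs = length rs" "i < length rs" "j < length rs" "distinct rs" "distinct cs"
    and agree: "\<And>r c. r \<in> set rs \<Longrightarrow> c \<in> set cs \<Longrightarrow> r \<noteq> rs ! i \<or> c \<noteq> cs ! j \<Longrightarrow> A r c = B r c"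
    and zero: "B (rs ! i) (cs ! j) = 0"
  shows "list_minor A rs cs = list_minor B rs cs +
    A (rs ! i) (cs ! j) * ((-1) ^ (i + j) * list_minor A (skip i rs) (skip j cs))"
proof -
  let ?t = "\<lambda>A b. A (rs ! i) (cs ! b) * ((-1) ^ (i + b) * list_minor A (skip i rs) (skip b cs))"
  have skip_eq: "list_minor A (skip i rs) (skip b cs) = list_minor B (skip i rs) (skip b cs)"
    if "b < length rs" for b
    by (rule list_minor_cong_set) (use assms that in \<open>auto simp: set_skip\<close>)
  have "list_minor A rs cs = (\<Sum>b<length rs. ?t A b)"
    by (rule list_minor_expand_row) (use assms in auto)
  also have "\<dots> = ?t A j + (\<Sum>b\<in>{..<length rs} - {j}. ?t A b)"
    using assms by (intro sum.remove) auto
  also have "(\<Sum>b\<in>{..<length rs} - {j}. ?t A b) = (\<Sum>b\<in>{..<length rs} - {j}. ?t B b)"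
  proof (intro sum.cong refl)
    fix b assume b: "b \<in> {..<length rs} - {j}"
    then have "A (rs ! i) (cs ! b) = B (rs ! i) (cs ! b)"
      using assms by (intro agree) (auto simp: nth_eq_iff_index_eq)
    with b show "?t A b = ?t B b" by (simp add: skip_eq)
  qed
  \<comment> \<open>The summand of \<open>j\<close> can be put back, since this entry of
    \<open>B\<close> is zero.\<close>
  also have "\<dots> = (\<Sum>b<length rs. ?t B b)"
    using assms by (subst sum.remove[of _ j]) auto
  also have "\<dots> = list_minor B rs cs"
    by (rule list_minor_expand_row[symmetric]) (use assms in auto)
  finally show ?thesis by (simp add: add.commute)
qed


section \<open>Minors of duplications\<close>

text \<open>\<open>fst p\<close> is the vertex of which \<open>p\<close> is a copy; the Laplacian of a duplication has \<open>y = mvar\<close>.\<close>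

definition blowup :: "('v \<Rightarrow> 'v \<Rightarrow> int) \<Rightarrow> ('v \<times> nat \<Rightarrow> 'b) \<Rightarrow> 'v \<times> nat \<Rightarrow> 'v \<times> nat \<Rightarrow> 'b::comm_ring_1"
  where "blowup W y p q =
    (if p = q then y p else if fst p = fst q then 0 else of_int (W (fst p) (fst q)))"

text \<open>Transposition only reverses the weights \<open>W\<close>, so that statements about rows
  carry over to columns.\<close>

lemma blowup_transpose: "blowup W y p q = blowup (\<lambda>u w. W w u) y q p"
  by (auto simp: blowup_def)

lemma list_minor_blowup_transpose:
  assumes "length cs = length rs"
  shows "list_minor (blowup W y) rs cs = list_minor (blowup (\<lambda>u w. W w u) y) cs rs"
  unfolding list_minor_transpose[OF assms]
  by (rule list_minor_cong) (auto simp: blowup_transpose[of W] assms)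

section \<open>Pulling copy variables out of a minor\<close>

text \<open>The variable \<open>y s\<close> sits in a single entry of the submatrix, at position
  \<open>(0, 0)\<close>, where the cofactor carries the sign \<open>+1\<close>.\<close>

lemma blowup_Cons_Cons:
  assumes "length C = length R" "distinct (s # R)" "distinct (s # C)"
  shows "list_minor (blowup W y) (s # R) (s # C) =
    list_minor (blowup W (y(s := 0))) (s # R) (s # C) + y s * list_minor (blowup W y) R C"
proof -
  have "list_minor (blowup W y) (s # R) (s # C) = list_minor (blowup W (y(s := 0))) (s # R) (s # C) +
    blowup W y ((s # R) ! 0) ((s # C) ! 0) *
      ((-1) ^ (0 + 0) * list_minor (blowup W y) (skip 0 (s # R)) (skip 0 (s # C)))"
    by (rule list_minor_change_entry) (use assms in \<open>auto simp: blowup_def\<close>)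
  then show ?thesis by (simp add: blowup_def[of W y s s])
qed

text \<open>Once \<open>y s = 0\<close>, the rows \<open>s\<close> and \<open>r\<close> agree, because \<open>r\<close> is no column.\<close>

lemma blowup_pull_row:
  assumes len: "length C = length R" and dist: "distinct (s # R)" "distinct (s # C)"
    and r: "r \<in> set R" "fst r = fst s" "r \<notin> set C"
  shows "list_minor (blowup W y) (s # R) (s # C) = y s * list_minor (blowup W y) R C"
proof -
  obtain i where i: "i < length R" "R ! i = r" using r by (auto simp: in_set_conv_nth)
  have "list_minor (blowup W (y(s := 0))) (s # R) (s # C) = 0"
  proof (rule list_minor_identical_rows[of 0 _ "Suc i"])
    fix q assume "q \<in> set (s # C)"
    moreover have "r \<noteq> s" using dist(1) r(1) by auto
    ultimately have "blowup W (y(s := 0)) s q = blowup W (y(s := 0)) r q"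
      using r(2,3) by (auto simp: blowup_def)
    with i show "blowup W (y(s := 0)) ((s # R) ! 0) q = blowup W (y(s := 0)) ((s # R) ! Suc i) q"
      by simp
  qed (use i len in auto)
  then show ?thesis by (simp add: blowup_Cons_Cons[OF len dist, of W y])
qed

text \<open>The copies in \<open>S\<close> are pulled out one by one. The row \<open>r\<close>
  serves every time: by distinctness it is not in \<open>S\<close>, hence never among the
  columns.\<close>

lemma blowup_pull_rows:
  assumes "length C = length R" "distinct (S @ R)" "distinct (S @ C)"
    and "r \<in> set R" "r \<notin> set C" "\<And>s. s \<in> set S \<Longrightarrow> fst s = fst r"
  shows "list_minor (blowup W y) (S @ R) (S @ C) = prod y (set S) * list_minor (blowup W y) R C"
  using assms
proof (induction S)
  case (Cons s S)
  have "list_minor (blowup W y) (s # S @ R) (s # S @ C) = y s * list_minor (blowup W y) (S @ R) (S @ C)"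
    by (rule blowup_pull_row[of _ _ _ r]) (use Cons.prems in auto)
  with Cons show ?case by (simp add: mult.assoc)
qed simp

lemma blowup_pull_cols:
  assumes "length C = length R" "distinct (S @ R)" "distinct (S @ C)"
    and "r \<in> set C" "r \<notin> set R" "\<And>s. s \<in> set S \<Longrightarrow> fst s = fst r"
  shows "list_minor (blowup W y) (S @ R) (S @ C) = prod y (set S) * list_minor (blowup W y) R C"
  using blowup_pull_rows[of R C S r "\<lambda>u w. W w u" y] assms
  by (simp add: list_minor_blowup_transpose[of _ _ W])

text \<open>Column \<open>t\<close> stands in for column \<open>s\<close> with a zero on the diagonal.\<close>

lemma blowup_diff:
  assumes len: "length C = length R" and dist: "distinct (s # R)" "distinct (s # C)"
    and t: "t \<noteq> s" "fst t = fst s" "t \<notin> set R" "t \<notin> set C"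
  shows "y s * list_minor (blowup W y) R C =
    list_minor (blowup W y) (s # R) (s # C) - list_minor (blowup W y) (s # R) (t # C)"
proof -
  have "list_minor (blowup W (y(s := 0))) (s # R) (s # C) = list_minor (blowup W y) (s # R) (t # C)"
  proof (rule list_minor_cong)
    fix a b assume "a < length (s # R)" "b < length (s # R)"
    then show "blowup W (y(s := 0)) ((s # R) ! a) ((s # C) ! b) = blowup W y ((s # R) ! a) ((t # C) ! b)"
      using assms by (cases a; cases b) (auto simp: blowup_def in_set_conv_nth)
  qed simp
  then show ?thesis by (simp add: blowup_Cons_Cons[OF len dist, of W y])
qed

text \<open>Here the spare copy \<open>t\<close> is neither a row nor a column. By
  \<open>blowup_diff\<close>, pulling out \<open>s\<close> produces a second minor in which column
  \<open>t\<close> replaces column \<open>s\<close>. There \<open>s\<close> is a row without its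
  column, so the rest of \<open>S\<close> is pulled out by \<open>blowup_pull_rows\<close> and the
  product is again a single minor of the full size.\<close>

lemma blowup_pull_mem:
  assumes diff: "\<And>a b. a \<in> J \<Longrightarrow> b \<in> J \<Longrightarrow> a - b \<in> J"
    and J: "minors U (blowup W y) (length S + length R) \<subseteq> J"
    and "length C = length R" "distinct (t # S @ R)" "distinct (t # S @ C)"
    and "\<And>s. s \<in> set S \<Longrightarrow> fst s = fst t"
    and "insert t (set S \<union> set R \<union> set C) \<subseteq> U"
  shows "prod y (set S) * list_minor (blowup W y) R C \<in> J"
  using assms(2-)
proof (induction S arbitrary: R C)
  case Nil
  then show ?case by (auto intro!: minorsI subsetD[OF Nil.prems(1)])
next
  case (Cons s S)
  \<comment> \<open>Moving \<open>s\<close> from \<open>S\<close> to both lists keeps the total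
    size, and \<open>t\<close> stays spare.\<close>
  have "prod y (set S) * list_minor (blowup W y) (s # R) (s # C) \<in> J"
    by (rule Cons.IH) (use Cons.prems in auto)
  moreover have "prod y (set S) * list_minor (blowup W y) (s # R) (t # C) =
      list_minor (blowup W y) (S @ s # R) (S @ t # C)"
    by (rule blowup_pull_rows[of _ _ _ s, symmetric]) (use Cons.prems in auto)
  moreover have "list_minor (blowup W y) (S @ s # R) (S @ t # C) \<in> J"
    using Cons.prems by (auto intro!: minorsI subsetD[OF Cons.prems(1)])
  moreover have "y s * list_minor (blowup W y) R C =
      list_minor (blowup W y) (s # R) (s # C) - list_minor (blowup W y) (s # R) (t # C)"
    by (rule blowup_diff) (use Cons.prems in auto)
  moreover have "prod y (set (s # S)) * list_minor (blowup W y) R C =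
      prod y (set S) * (y s * list_minor (blowup W y) R C)"
    using Cons.prems by (simp add: ac_simps)
  ultimately show ?case
    by (simp only: right_diff_distrib diff)
qed

section \<open>Setting copy variables to zero\<close>

text \<open>The vertex set of an \<open>m\<close>-fold duplication of \<open>v\<close>, in terms of
  the vertex set \<open>V\<close> alone.\<close>

definition dup_verts :: "'v set \<Rightarrow> 'v \<Rightarrow> nat \<Rightarrow> ('v \<times> nat) set" where
  "dup_verts V v m = {p. fst p \<in> V \<and> snd p \<le> (if fst p = v then m else 0)}"

text \<open>With zero diagonal at all copies of \<open>v\<close>, an entry depends only on the
  originals of its row and its column. Two rows or two columns with the same original are therefore
  equal; without such a repetition, \<open>fst\<close> maps the index lists to distinct lists in
  \<open>V\<close>.\<close>

lemma minors_blowup_zero: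
  assumes \<mu>: "\<mu> \<in> minors (dup_verts V v m) (blowup W y) j" and y: "\<And>c. y (v, c) = 0"
  shows "\<mu> = 0 \<or> \<mu> \<in> minors V (\<lambda>u w. blowup W y (u, 0) (w, 0)) j"
proof -
  obtain rs cs where *: "\<mu> = list_minor (blowup W y) rs cs" "distinct rs" "distinct cs"
    "length rs = j" "length cs = j" "set rs \<subseteq> dup_verts V v m" "set cs \<subseteq> dup_verts V v m"
    using \<mu> by (rule minorsE)
  \<comment> \<open>For two copies of \<open>v\<close>, equal or not, both sides vanish; any other
    vertex has one copy only.\<close>
  have eq: "blowup W y p q = blowup W y (fst p, 0) (fst q, 0)"
    if "p \<in> dup_verts V v m" "q \<in> dup_verts V v m" for p q
    using that y by (cases p; cases q) (auto simp: blowup_def dup_verts_def split: if_splits)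
  have mem: "rs ! a \<in> dup_verts V v m" "cs ! a \<in> dup_verts V v m" if "a < j" for a
    using that *(4-7) nth_mem[of a rs] nth_mem[of a cs] by auto
  consider "inj_on fst (set rs)" "inj_on fst (set cs)" | "\<not> inj_on fst (set rs)" | "\<not> inj_on fst (set cs)"
    by blast
  then show ?thesis
  proof cases
    case 1
    have "\<mu> = list_minor (\<lambda>p q. blowup W y (fst p, 0) (fst q, 0)) rs cs"
      unfolding *(1) by (rule list_minor_cong_set) (use * eq in blast)+
    also have "\<dots> = list_minor (\<lambda>u w. blowup W y (u, 0) (w, 0)) (map fst rs) (map fst cs)"
      by (rule list_minor_map[symmetric]) (use * in simp)
    also have "\<dots> \<in> minors V (\<lambda>u w. blowup W y (u, 0) (w, 0)) j"
      by (rule minorsI) (use 1 * in \<open>auto simp: distinct_map dup_verts_def\<close>)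
    finally show ?thesis ..
  next
    case 2
    then obtain a b where ab: "a < length rs" "b < length rs" "a \<noteq> b" "fst (rs ! a) = fst (rs ! b)"
      unfolding inj_on_def by (metis in_set_conv_nth)
    have "blowup W y (rs ! a) q = blowup W y (rs ! b) q" if "q \<in> set cs" for q
      using *(4,7) ab that mem[of a] mem[of b] eq[of "rs ! a" q] eq[of "rs ! b" q] by auto
    then have "\<mu> = 0"
      unfolding *(1) by (intro list_minor_identical_rows[OF ab(1-3)]) (use *(4,5) in auto)
    then show ?thesis ..
  next
    case 3
    then obtain a b where ab: "a < length cs" "b < length cs" "a \<noteq> b" "fst (cs ! a) = fst (cs ! b)"
      unfolding inj_on_def by (metis in_set_conv_nth)
    have "blowup W y p (cs ! a) = blowup W y p (cs ! b)" if "p \<in> set rs" for p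
      using *(5,6) ab that mem[of a] mem[of b] eq[of p "cs ! a"] eq[of p "cs ! b"] by auto
    then have "\<mu> = 0"
      unfolding *(1) by (intro list_minor_identical_cols[OF ab(1-3)]) (use *(4,5) in auto)
    then show ?thesis ..
  qed
qed

text \<open>Induction on the set \<open>K\<close> of copies whose variables are still present. For
  each of them \<open>list_minor_change_entry\<close> splits the minor, and the variable that comes
  out is collected in the factor \<open>z\<close>; hence \<open>z\<close> and the size
  \<open>j\<close> are generalized. For empty \<open>K\<close>, \<open>minors_blowup_zero\<close>
  applies.\<close>

lemma minors_blowup_mem:
  assumes J: "0 \<in> J" "\<And>a b. a \<in> J \<Longrightarrow> b \<in> J \<Longrightarrow> a + b \<in> J" "\<And>a. a \<in> J \<Longrightarrow> - a \<in> J"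
    and "finite K"
    and "\<And>S \<delta>. S \<subseteq> K \<Longrightarrow> card S \<le> j \<Longrightarrow>
      \<delta> \<in> minors V (\<lambda>u w. blowup W (\<lambda>p. if fst p = v then 0 else y p) (u, 0) (w, 0)) (j - card S) \<Longrightarrow>
      z * (\<Prod>c\<in>S. y (v, c)) * \<delta> \<in> J"
    and "\<mu> \<in> minors (dup_verts V v m) (blowup W (\<lambda>p. if fst p = v \<and> snd p \<notin> K then 0 else y p)) j"
  shows "z * \<mu> \<in> J"
  using assms(4-)
proof (induction K arbitrary: z j \<mu> rule: finite_induct)
  case empty
  have "\<mu> = 0 \<or> \<mu> \<in> minors V (\<lambda>u w. blowup W (\<lambda>p. if fst p = v then 0 else y p) (u, 0) (w, 0)) j"
    by (rule minors_blowup_zero) (use empty.prems(2) in auto)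
  with empty.prems(1)[of "{}" \<mu>] J(1) show ?case by auto
next
  case (insert c K)
  define yK where "yK K p = (if fst p = v \<and> snd p \<notin> K then 0 else y p)" for K p
  have IH: "z * \<mu> \<in> J" if "\<And>S \<delta>. S \<subseteq> K \<Longrightarrow> card S \<le> j \<Longrightarrow>
      \<delta> \<in> minors V (\<lambda>u w. blowup W (\<lambda>p. if fst p = v then 0 else y p) (u, 0) (w, 0)) (j - card S) \<Longrightarrow>
      z * (\<Prod>c\<in>S. y (v, c)) * \<delta> \<in> J" "\<mu> \<in> minors (dup_verts V v m) (blowup W (yK K)) j"
    for z j \<mu>
    using insert.IH[of j z \<mu>] that unfolding yK_def by blast
  obtain rs cs where *: "\<mu> = list_minor (blowup W (yK (insert c K))) rs cs" "distinct rs" "distinct cs"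
    "length rs = j" "length cs = j" "set rs \<subseteq> dup_verts V v m" "set cs \<subseteq> dup_verts V v m"
    using insert.prems(2) unfolding yK_def by (rule minorsE)
  have K: "z * list_minor (blowup W (yK K)) rs cs \<in> J"
    by (rule IH[of j]) (use insert.prems(1) * in \<open>blast intro: minorsI\<close>)+
  have agree: "blowup W (yK (insert c K)) p q = blowup W (yK K) p q"
    if "p \<noteq> (v, c) \<or> q \<noteq> (v, c)" for p q
    using that by (cases p; cases q) (auto simp: blowup_def yK_def)
  show ?case
  proof (cases "(v, c) \<in> set rs \<and> (v, c) \<in> set cs")
    case False
    have "\<mu> = list_minor (blowup W (yK K)) rs cs"
      unfolding *(1) by (rule list_minor_cong_set) (use * False in \<open>auto intro!: agree\<close>)
    with K show ?thesis by simp
  next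
    case True
    then obtain a b where ab: "a < length rs" "rs ! a = (v, c)" "b < length cs" "cs ! b = (v, c)"
      by (auto simp: in_set_conv_nth)
    let ?m = "list_minor (blowup W (yK K)) (skip a rs) (skip b cs)"
    have entry: "blowup W (yK K) (rs ! a) (cs ! b) = 0"
      "blowup W (yK (insert c K)) (rs ! a) (cs ! b) = y (v, c)"
      using ab insert.hyps by (auto simp: blowup_def yK_def)
    have "\<mu> = list_minor (blowup W (yK K)) rs cs + blowup W (yK (insert c K)) (rs ! a) (cs ! b) *
        ((-1) ^ (a + b) * list_minor (blowup W (yK (insert c K))) (skip a rs) (skip b cs))"
      unfolding *(1)
      by (rule list_minor_change_entry) (use * ab entry in \<open>auto intro!: agree\<close>)
    also have "list_minor (blowup W (yK (insert c K))) (skip a rs) (skip b cs) = ?m"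
      by (rule list_minor_cong_set) (use * ab in \<open>auto simp: set_skip intro!: agree\<close>)
    finally have \<mu>: "z * \<mu> = z * list_minor (blowup W (yK K)) rs cs +
        (-1) ^ (a + b) * (z * y (v, c) * ?m)"
      unfolding entry by (simp add: algebra_simps)
    have "z * y (v, c) * ?m \<in> J"
    proof (rule IH[of "j - 1"])
      show "?m \<in> minors (dup_verts V v m) (blowup W (yK K)) (j - 1)"
        by (rule minorsI) (use * ab in \<open>auto simp: distinct_skip set_skip\<close>)
      fix S \<delta>
      assume S: "S \<subseteq> K" "card S \<le> j - 1" "\<delta> \<in> minors V
        (\<lambda>u w. blowup W (\<lambda>p. if fst p = v then 0 else y p) (u, 0) (w, 0)) (j - 1 - card S)"
      then have "finite S" "c \<notin> S" using insert.hyps finite_subset by auto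
      \<comment> \<open>The set \<open>S\<close> for size \<open>j - 1\<close> corresponds to
        \<open>insert c S\<close> for size \<open>j\<close>; the additional variable is the factor
        \<open>y (v, c)\<close>.\<close>
      then show "z * y (v, c) * (\<Prod>c\<in>S. y (v, c)) * \<delta> \<in> J"
        using insert.prems(1)[of "insert c S" \<delta>] S *(4) ab
        by (auto simp: mult.assoc subset_insertI2 Suc_le_eq)
    qed
    then have "(-1) ^ (a + b) * (z * y (v, c) * ?m) \<in> J"
      using J(3) by (cases "even (a + b)") auto
    then show ?thesis unfolding \<mu> using K J(2) by blast
  qed
qed


section \<open>Ideals of polynomial rings\<close>

lemma mpol_ring_simps [simp]:
  "x \<otimes>\<^bsub>mpol_ring V\<^esub> y = x * y" "x \<oplus>\<^bsub>mpol_ring V\<^esub> y = x + y"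
  "\<zero>\<^bsub>mpol_ring V\<^esub> = 0" "\<one>\<^bsub>mpol_ring V\<^esub> = 1"
  by (simp_all add: mpol_ring_def ring_of_type_algebra_def)

lemma mpol_carrier: "carrier (mpol_ring V) = {p. \<forall>m\<in>Poly_Mapping.keys p. Poly_Mapping.keys m \<subseteq> V}"
  by (simp add: mpol_ring_def)

lemma mpol_add_closed: "p \<in> carrier (mpol_ring V) \<Longrightarrow> q \<in> carrier (mpol_ring V) \<Longrightarrow> p + q \<in> carrier (mpol_ring V)"
  using keys_add[of p q] by (auto simp: mpol_carrier)

lemma mpol_uminus_closed: "p \<in> carrier (mpol_ring V) \<Longrightarrow> - p \<in> carrier (mpol_ring V)"
  by (simp add: mpol_carrier in_keys_iff)

lemma mpol_mult_closed:
  assumes "p \<in> carrier (mpol_ring V)" "q \<in> carrier (mpol_ring V)"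
  shows "p * q \<in> carrier (mpol_ring V)"
proof -
  have "Poly_Mapping.keys (a + b) \<subseteq> V"
    if "a \<in> Poly_Mapping.keys p" "b \<in> Poly_Mapping.keys q" for a b
    using order.trans[OF keys_add[of a b]] that assms by (simp add: mpol_carrier)
  then show ?thesis using keys_mult[of p q] by (fastforce simp: mpol_carrier)
qed

lemma mpol_const_closed: "Poly_Mapping.single 0 c \<in> carrier (mpol_ring V)"
  by (simp add: mpol_carrier)

lemma mpol_zero_closed: "0 \<in> carrier (mpol_ring V)"
  by (simp add: mpol_carrier)

lemma mpol_one_closed: "1 \<in> carrier (mpol_ring V)"
  by (simp add: mpol_carrier)

lemma mpol_mvar_closed: "u \<in> V \<Longrightarrow> mvar u \<in> carrier (mpol_ring V)"
  by (simp add: mpol_carrier mvar_def)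

lemma mpol_of_int_closed: "of_int n \<in> carrier (mpol_ring V)"
proof (induction n rule: int_induct[of _ 0])
  case (step2 i)
  then show ?case
    using mpol_add_closed[OF _ mpol_uminus_closed[OF mpol_one_closed], of "of_int i" V] by simp
qed (auto intro: mpol_add_closed mpol_one_closed mpol_zero_closed)

lemma mpol_sum_closed: "(\<And>i. i \<in> A \<Longrightarrow> f i \<in> carrier (mpol_ring V)) \<Longrightarrow> sum f A \<in> carrier (mpol_ring V)"
  by (induction A rule: infinite_finite_induct) (auto intro: mpol_add_closed mpol_zero_closed)

lemma mpol_prod_closed: "(\<And>i. i \<in> A \<Longrightarrow> f i \<in> carrier (mpol_ring V)) \<Longrightarrow> prod f A \<in> carrier (mpol_ring V)"
  by (induction A rule: infinite_finite_induct) (auto intro: mpol_mult_closed mpol_one_closed)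

lemma mpol_power_closed: "p \<in> carrier (mpol_ring V) \<Longrightarrow> p ^ n \<in> carrier (mpol_ring V)"
  by (induction n) (auto intro: mpol_mult_closed mpol_one_closed)

lemmas mpol_closed = mpol_add_closed mpol_uminus_closed mpol_mult_closed mpol_const_closed
  mpol_zero_closed mpol_one_closed mpol_mvar_closed mpol_of_int_closed mpol_sum_closed
  mpol_prod_closed mpol_power_closed

lemma mpol_cring: "cring (mpol_ring V)"
proof (intro cringI abelian_groupI comm_monoidI)
  fix x :: "('a, 'b) mpol" assume "x \<in> carrier (mpol_ring V)"
  then show "\<exists>y\<in>carrier (mpol_ring V). y \<oplus>\<^bsub>mpol_ring V\<^esub> x = \<zero>\<^bsub>mpol_ring V\<^esub>"
    by (intro bexI[of _ "- x"] mpol_closed) auto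
qed (auto simp: algebra_simps intro: mpol_closed)

lemma mpol_ring: "ring (mpol_ring V)"
  using mpol_cring cring.axioms(1) by blast

lemma mpol_a_inv:
  assumes "x \<in> carrier (mpol_ring V)"
  shows "\<ominus>\<^bsub>mpol_ring V\<^esub> x = - x"
proof -
  interpret cring "mpol_ring V" by (rule mpol_cring)
  show ?thesis using assms by (intro minus_equality) (auto intro: mpol_closed)
qed

section \<open>Ideals, generators and homomorphisms\<close>

lemma mpol_idealI:
  assumes "J \<subseteq> carrier (mpol_ring V)" "0 \<in> J"
    and "\<And>a b. a \<in> J \<Longrightarrow> b \<in> J \<Longrightarrow> a + b \<in> J"
    and mult: "\<And>a r. a \<in> J \<Longrightarrow> r \<in> carrier (mpol_ring V) \<Longrightarrow> r * a \<in> J"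
  shows "ideal J (mpol_ring V)"
proof (rule idealI[OF mpol_ring])
  have "- a \<in> J" if "a \<in> J" for a
    using mult[OF that mpol_uminus_closed[OF mpol_one_closed]] by simp
  moreover have "inv\<^bsub>add_monoid (mpol_ring V)\<^esub> a = - a" if "a \<in> J" for a
    using mpol_a_inv[of a V] that assms(1) unfolding a_inv_def by blast
  ultimately show "subgroup J (add_monoid (mpol_ring V))"
    by (intro subgroup.intro) (simp_all add: assms)
qed (use mult in \<open>auto simp: mult.commute\<close>)

lemma mpol_idealD:
  assumes "ideal J (mpol_ring V)"
  shows "0 \<in> J" "a \<in> J \<Longrightarrow> b \<in> J \<Longrightarrow> a + b \<in> J" "a \<in> J \<Longrightarrow> - a \<in> J"
    "a \<in> J \<Longrightarrow> b \<in> J \<Longrightarrow> a - b \<in> J"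
    "a \<in> J \<Longrightarrow> r \<in> carrier (mpol_ring V) \<Longrightarrow> r * a \<in> J"
    "a \<in> J \<Longrightarrow> a \<in> carrier (mpol_ring V)"
proof -
  interpret ideal J "mpol_ring V" by (rule assms)
  have neg: "- b \<in> J" if "b \<in> J" for b
    using I_l_closed[OF that, of "- 1"] by (simp add: mpol_closed)
  show "0 \<in> J"
    using additive_subgroup.zero_closed[OF additive_subgroup_axioms] by simp
  show add: "a + b \<in> J" if "a \<in> J" "b \<in> J" for a b
    using additive_subgroup.a_closed[OF additive_subgroup_axioms that] by simp
  show "- a \<in> J" if "a \<in> J"
    using neg that .
  show "a - b \<in> J" if "a \<in> J" "b \<in> J"
    using add[OF that(1) neg[OF that(2)]] by simp
  show "r * a \<in> J" if "a \<in> J" "r \<in> carrier (mpol_ring V)"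
    using I_l_closed[OF that] by simp
  show "a \<in> carrier (mpol_ring V)" if "a \<in> J"
    using a_subset that by blast
qed

lemmas mpol_genideal_ideal = ring.genideal_ideal[OF mpol_ring]
  and mpol_genideal_self = ring.genideal_self[OF mpol_ring]
  and mpol_genideal_minimal = ring.genideal_minimal[OF mpol_ring]

text \<open>The polynomials \<open>p\<close> for which \<open>z * \<phi> p\<close> lies in
  \<open>J\<close> form an ideal, so checking the generators suffices. The factor \<open>z\<close>
  makes room for products of copy variables.\<close>

lemma mpol_genideal_image_mem:
  fixes \<phi> :: "('v, 'a::comm_ring_1) mpol \<Rightarrow> ('w, 'b::comm_ring_1) mpol"
  assumes hom: "comm_ring_hom \<phi>"
    and closed: "\<And>p. p \<in> carrier (mpol_ring V) \<Longrightarrow> \<phi> p \<in> carrier (mpol_ring V')"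
    and J: "ideal J (mpol_ring V')" and S: "S \<subseteq> carrier (mpol_ring V)"
    and mem: "\<And>s. s \<in> S \<Longrightarrow> z * \<phi> s \<in> J" and p: "p \<in> Idl\<^bsub>mpol_ring V\<^esub> S"
  shows "z * \<phi> p \<in> J"
proof -
  interpret comm_ring_hom \<phi> by (rule hom)
  have "ideal {p \<in> carrier (mpol_ring V). z * \<phi> p \<in> J} (mpol_ring V)"
  proof (rule mpol_idealI)
    show "0 \<in> {p \<in> carrier (mpol_ring V). z * \<phi> p \<in> J}"
      by (simp add: mpol_closed mpol_idealD(1)[OF J])
  next
    fix a b assume "a \<in> {p \<in> carrier (mpol_ring V). z * \<phi> p \<in> J}"
      "b \<in> {p \<in> carrier (mpol_ring V). z * \<phi> p \<in> J}"
    then show "a + b \<in> {p \<in> carrier (mpol_ring V). z * \<phi> p \<in> J}"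
      by (simp add: mpol_closed hom_distribs distrib_left mpol_idealD(2)[OF J])
  next
    fix a r :: "('v, 'a) mpol"
    assume *: "a \<in> {p \<in> carrier (mpol_ring V). z * \<phi> p \<in> J}" "r \<in> carrier (mpol_ring V)"
    then have "\<phi> r * (z * \<phi> a) \<in> J" by (blast intro: mpol_idealD(5)[OF J] closed)
    then have "z * \<phi> (r * a) \<in> J" by (simp add: hom_distribs ac_simps)
    with * show "r * a \<in> {p \<in> carrier (mpol_ring V). z * \<phi> p \<in> J}" by (simp add: mpol_closed)
  qed auto
  from mpol_genideal_minimal[OF this, of S] show ?thesis
    using S mem p by auto
qed

lemma mpol_genideal_scale_mem:
  assumes "ideal J (mpol_ring V)" "S \<subseteq> carrier (mpol_ring V)"
    and "\<And>s. s \<in> S \<Longrightarrow> z * s \<in> J" "p \<in> Idl\<^bsub>mpol_ring V\<^esub> S"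
  shows "z * p \<in> J"
proof -
  have "comm_ring_hom (\<lambda>x :: ('a, 'b) mpol. x)" by unfold_locales auto
  from mpol_genideal_image_mem[OF this _ assms(1,2,3,4)] show ?thesis by simp
qed

lemma mpol_genideal_image:
  assumes hom: "comm_ring_hom \<phi>"
    and closed: "\<And>p. p \<in> carrier (mpol_ring V) \<Longrightarrow> \<phi> p \<in> carrier (mpol_ring V')"
    and S: "S \<subseteq> carrier (mpol_ring V)"
  shows "Idl\<^bsub>mpol_ring V'\<^esub> (\<phi> ` (Idl\<^bsub>mpol_ring V\<^esub> S)) = Idl\<^bsub>mpol_ring V'\<^esub> (\<phi> ` S)"
proof
  have S': "\<phi> ` S \<subseteq> carrier (mpol_ring V')"
    and IS': "\<phi> ` (Idl\<^bsub>mpol_ring V\<^esub> S) \<subseteq> carrier (mpol_ring V')"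
    using S closed mpol_idealD(6)[OF mpol_genideal_ideal[OF S]] by auto
  have "1 * \<phi> p \<in> Idl\<^bsub>mpol_ring V'\<^esub> (\<phi> ` S)" if "p \<in> Idl\<^bsub>mpol_ring V\<^esub> S" for p
    by (rule mpol_genideal_image_mem[OF hom closed mpol_genideal_ideal[OF S'] S _ that])
      (use mpol_genideal_self[OF S'] in auto)
  then show "Idl\<^bsub>mpol_ring V'\<^esub> (\<phi> ` (Idl\<^bsub>mpol_ring V\<^esub> S)) \<subseteq> Idl\<^bsub>mpol_ring V'\<^esub> (\<phi> ` S)"
    by (intro mpol_genideal_minimal mpol_genideal_ideal S') auto
  show "Idl\<^bsub>mpol_ring V'\<^esub> (\<phi> ` S) \<subseteq> Idl\<^bsub>mpol_ring V'\<^esub> (\<phi> ` (Idl\<^bsub>mpol_ring V\<^esub> S))"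
    using mpol_genideal_self[OF IS'] mpol_genideal_self[OF S]
    by (intro mpol_genideal_minimal mpol_genideal_ideal IS') auto
qed

section \<open>Minors and ideals of polynomials\<close>

text \<open>The Leibniz formula writes the minor as a sum of signed products of entries.\<close>

lemma list_minor_closed:
  assumes "\<And>r c. r \<in> set rs \<Longrightarrow> c \<in> set cs \<Longrightarrow> A r c \<in> carrier (mpol_ring V)" "length cs = length rs"
  shows "list_minor A rs cs \<in> carrier (mpol_ring V)"
proof -
  let ?n = "length rs"
  have "signof p * (\<Prod>i = 0..<?n. A (rs ! i) (cs ! p i)) \<in> carrier (mpol_ring V)"
    if "p permutes {0..<?n}" for p
  proof (intro mpol_mult_closed mpol_prod_closed)
    show "signof p \<in> carrier (mpol_ring V)" by (simp add: sign_def mpol_closed)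
    fix i assume "i \<in> {0..<?n}"
    moreover from this have "p i < ?n" using permutes_in_image[OF that, of i] by simp
    ultimately show "A (rs ! i) (cs ! p i) \<in> carrier (mpol_ring V)" using assms by auto
  qed
  moreover have "list_minor A rs cs = (\<Sum>p | p permutes {0..<?n}.
      signof p * (\<Prod>i = 0..<?n. A (rs ! i) (cs ! p i)))"
    unfolding list_minor_def det_def'[OF mat_carrier]
    by (intro sum.cong refl arg_cong2[where f = times] prod.cong)
      (use permutes_in_image in fastforce)+
  ultimately show ?thesis by (auto intro: mpol_sum_closed)
qed

lemma minors_closed:
  assumes "\<And>r c. r \<in> U \<Longrightarrow> c \<in> U \<Longrightarrow> A r c \<in> carrier (mpol_ring V)"
  shows "minors U A i \<subseteq> carrier (mpol_ring V)"
  using assms by (auto elim!: minorsE intro!: list_minor_closed)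

text \<open>Laplace expansion along row \<open>i\<close> is a linear combination, with coefficients
  in the ring, of the minors assumed to lie in \<open>J\<close>.\<close>

lemma list_minor_mem_ideal:
  assumes J: "ideal J (mpol_ring V)" and len: "length cs = length rs" and i: "i < length rs"
    and A: "\<And>r c. r \<in> set rs \<Longrightarrow> c \<in> set cs \<Longrightarrow> A r c \<in> carrier (mpol_ring V)"
    and mem: "\<And>j. j < length rs \<Longrightarrow> list_minor A (skip i rs) (skip j cs) \<in> J"
  shows "list_minor A rs cs \<in> J"
proof -
  have sum_mem: "sum f {..<n} \<in> J" if "\<And>j. j < n \<Longrightarrow> f j \<in> J" for f and n :: nat
    using that by (induction n) (auto simp: lessThan_Suc intro: mpol_idealD(1,2)[OF J])
  have "A (rs ! i) (cs ! j) * ((-1) ^ (i + j) * list_minor A (skip i rs) (skip j cs)) \<in> J"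
    if "j < length rs" for j
  proof (intro mpol_idealD(5)[OF J] mem that)
    show "A (rs ! i) (cs ! j) \<in> carrier (mpol_ring V)" using A that len i by simp
    show "(-1) ^ (i + j) \<in> carrier (mpol_ring V)" by (intro mpol_closed)
  qed
  then show ?thesis
    unfolding list_minor_expand_row[OF len i] by (rule sum_mem)
qed

text \<open>Chooses the line to expand along: the one of \<open>x\<close> if it occurs, and
  otherwise an arbitrary one, so that the length drops in both cases.\<close>

lemma skip_avoiding:
  assumes "distinct xs" "xs \<noteq> []"
  obtains i where "i < length xs" "x \<notin> set (skip i xs)"
proof (cases "x \<in> set xs")
  case True
  then obtain i where "i < length xs" "xs ! i = x" by (auto simp: in_set_conv_nth)
  then show ?thesis using assms by (intro that[of i]) (auto simp: set_skip)
next
  case False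
  then show ?thesis using assms by (intro that[of 0]) (auto simp: set_skip)
qed

text \<open>Expanding along the row of \<open>v\<close> and then along the column of
  \<open>v\<close> leaves minors that avoid \<open>v\<close>. Each expansion lowers the size by one,
  which accounts for the shift by 2.\<close>

lemma minors_subset_ideal:
  assumes J: "ideal J (mpol_ring U)"
    and A: "\<And>r c. r \<in> V \<Longrightarrow> c \<in> V \<Longrightarrow> A r c \<in> carrier (mpol_ring U)"
    and mem: "minors (V - {v}) A n \<subseteq> J"
  shows "minors V A (n + 2) \<subseteq> J"
proof
  fix \<mu> assume "\<mu> \<in> minors V A (n + 2)"
  then obtain rs cs where *: "\<mu> = list_minor A rs cs" "distinct rs" "distinct cs"
    "length rs = n + 2" "length cs = n + 2" "set rs \<subseteq> V" "set cs \<subseteq> V"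
    by (rule minorsE)
  obtain i where i: "i < length rs" "v \<notin> set (skip i rs)"
    by (rule skip_avoiding[of rs v]) (use * in auto)
  show "\<mu> \<in> J"
    unfolding *(1)
  proof (rule list_minor_mem_ideal[OF J _ i(1)])
    fix j assume "j < length rs"
    define R C where "R = skip i rs" and "C = skip j cs"
    have RC: "distinct R" "distinct C" "length R = n + 1" "length C = n + 1"
      "set R \<subseteq> V - {v}" "set C \<subseteq> V"
      using * i \<open>j < length rs\<close> by (auto simp: R_def C_def distinct_skip set_skip)
    obtain a where a: "a < length C" "v \<notin> set (skip a C)"
      by (rule skip_avoiding[of C v]) (use RC in auto)
    \<comment> \<open>Expansion along a column is expansion along a row of the transposed
      matrix.\<close>
    have "list_minor (\<lambda>c r. A r c) C R \<in> J"
    proof (rule list_minor_mem_ideal[OF J _ a(1)])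
      fix b assume b: "b < length C"
      have "list_minor (\<lambda>c r. A r c) (skip a C) (skip b R) = list_minor A (skip b R) (skip a C)"
        by (rule list_minor_transpose[symmetric]) (use RC a b in auto)
      also have "\<dots> \<in> minors (V - {v}) A n"
        by (rule minorsI) (use RC a b in \<open>auto simp: distinct_skip set_skip\<close>)
      finally show "list_minor (\<lambda>c r. A r c) (skip a C) (skip b R) \<in> J" using mem by blast
    qed (use RC A in auto)
    then show "list_minor A R C \<in> J"
      using RC by (simp add: list_minor_transpose[of C R])
  qed (use * A in auto)
qed


section \<open>Substitution homomorphisms\<close>

lemma poly_mapping_sum_single:
  "p = (\<Sum>m\<in>Poly_Mapping.keys p. Poly_Mapping.single m (Poly_Mapping.lookup p m))"
proof (rule poly_mapping_eqI)
  fix k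
  have "(\<Sum>m\<in>Poly_Mapping.keys p. Poly_Mapping.lookup p m when m = k) = Poly_Mapping.lookup p k"
    by (auto simp: when_def in_keys_iff sum.delta')
  then show "Poly_Mapping.lookup p k =
      Poly_Mapping.lookup (\<Sum>m\<in>Poly_Mapping.keys p. Poly_Mapping.single m (Poly_Mapping.lookup p m)) k"
    by (simp add: lookup_sum lookup_single)
qed

definition monom_subst :: "('v \<Rightarrow> 'b::comm_ring_1) \<Rightarrow> ('v \<Rightarrow>\<^sub>0 nat) \<Rightarrow> 'b" where
  "monom_subst f m = (\<Prod>u\<in>Poly_Mapping.keys m. f u ^ Poly_Mapping.lookup m u)"

lemma monom_subst_superset:
  assumes "finite A" "Poly_Mapping.keys m \<subseteq> A"
  shows "monom_subst f m = (\<Prod>u\<in>A. f u ^ Poly_Mapping.lookup m u)"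
  unfolding monom_subst_def by (rule prod.mono_neutral_left) (use assms in \<open>auto simp: in_keys_iff\<close>)

lemma monom_subst_add: "monom_subst f (m + n) = monom_subst f m * monom_subst f n"
proof -
  let ?A = "Poly_Mapping.keys m \<union> Poly_Mapping.keys n"
  have "Poly_Mapping.keys (m + n) \<subseteq> ?A" by (rule keys_add)
  then show ?thesis
    by (simp add: monom_subst_superset[of ?A] lookup_add power_add prod.distrib)
qed

lemma mpol_subst_monom:
  "mpol_subst f p = (\<Sum>m\<in>Poly_Mapping.keys p. Poly_Mapping.single 0 (Poly_Mapping.lookup p m) * monom_subst f m)"
  by (simp add: mpol_subst_def monom_subst_def)

text \<open>Allows several polynomials to be expanded over a common index set, such as the union of
  their supports; additional monomials have coefficient zero.\<close>

lemma mpol_subst_superset: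
  assumes "finite A" "Poly_Mapping.keys p \<subseteq> A"
  shows "mpol_subst f p = (\<Sum>m\<in>A. Poly_Mapping.single 0 (Poly_Mapping.lookup p m) * monom_subst f m)"
  unfolding mpol_subst_monom
  by (rule sum.mono_neutral_left) (use assms in \<open>auto simp: in_keys_iff\<close>)

lemma mpol_subst_single: "mpol_subst f (Poly_Mapping.single m a) = Poly_Mapping.single 0 a * monom_subst f m"
  by (subst mpol_subst_superset[of "{m}"]) auto

lemma mpol_subst_mvar [simp]: "mpol_subst f (mvar u) = f u"
  by (simp add: mvar_def mpol_subst_single monom_subst_def)

lemma mpol_subst_add: "mpol_subst f (p + q) = mpol_subst f p + mpol_subst f q"
proof -
  let ?A = "Poly_Mapping.keys p \<union> Poly_Mapping.keys q"
  have "Poly_Mapping.keys (p + q) \<subseteq> ?A" by (rule keys_add)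
  then show ?thesis
    by (simp add: mpol_subst_superset[of ?A] lookup_add single_add distrib_right sum.distrib)
qed

lemma mpol_subst_sum: "mpol_subst f (sum g A) = (\<Sum>a\<in>A. mpol_subst f (g a))"
  by (induction A rule: infinite_finite_induct)
    (simp_all add: mpol_subst_add, simp_all add: mpol_subst_def)

text \<open>By additivity this reduces to products of two terms, where coefficients multiply and
  exponents add.\<close>

lemma mpol_subst_mult:
  fixes f :: "'v \<Rightarrow> ('w, 'a::comm_ring_1) mpol"
  shows "mpol_subst f (p * q) = mpol_subst f p * mpol_subst f q"
proof -
  let ?s = "\<lambda>p m. Poly_Mapping.single m (Poly_Mapping.lookup p m)"
  let ?t = "\<lambda>p m. Poly_Mapping.single 0 (Poly_Mapping.lookup p m) * monom_subst f m"
  have *: "mpol_subst f (?s p m * ?s q n) = ?t p m * ?t q n" for m n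
  proof -
    have "Poly_Mapping.single 0 (Poly_Mapping.lookup p m * Poly_Mapping.lookup q n) =
        Poly_Mapping.single 0 (Poly_Mapping.lookup p m) * (Poly_Mapping.single 0 (Poly_Mapping.lookup q n) :: ('w, 'a) mpol)"
      by (simp add: mult_single)
    then show ?thesis
      by (simp add: mult_single mpol_subst_single monom_subst_add ac_simps)
  qed
  have "p * q = (\<Sum>m\<in>Poly_Mapping.keys p. \<Sum>n\<in>Poly_Mapping.keys q. ?s p m * ?s q n)"
    unfolding sum_product[symmetric] poly_mapping_sum_single[symmetric] ..
  then have "mpol_subst f (p * q) =
      (\<Sum>m\<in>Poly_Mapping.keys p. \<Sum>n\<in>Poly_Mapping.keys q. ?t p m * ?t q n)"
    by (simp only: mpol_subst_sum *)
  then show ?thesis by (simp add: sum_product mpol_subst_monom)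
qed

lemma mpol_subst_hom: "comm_ring_hom (mpol_subst f)"
proof
  show "mpol_subst f 1 = 1"
    using mpol_subst_single[of f 0 1] by (simp add: monom_subst_def)
qed (simp_all add: mpol_subst_add mpol_subst_mult, simp add: mpol_subst_def)

lemma mpol_subst_closed:
  assumes "\<And>u. u \<in> V \<Longrightarrow> f u \<in> carrier (mpol_ring V')" "p \<in> carrier (mpol_ring V)"
  shows "mpol_subst f p \<in> carrier (mpol_ring V')"
  unfolding mpol_subst_def using assms
  by (intro mpol_sum_closed mpol_mult_closed mpol_const_closed mpol_prod_closed mpol_power_closed)
    (auto simp: mpol_carrier)


section \<open>Critical ideals of duplications\<close>

text \<open>The off-diagonal Laplacian entry as an integer: such entries lie in every
  \<open>mpol_ring V\<close> and are fixed by all substitutions. Without arcs the factor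
  \<open>arc_mult\<close> makes it zero, whatever the unspecified sign.\<close>

definition arc_weight :: "('v, 'e) pre_digraph \<Rightarrow> ('e \<Rightarrow> int) \<Rightarrow> 'v \<Rightarrow> 'v \<Rightarrow> int" where
  "arc_weight G \<sigma> u w = - pair_sign G \<sigma> u w * int (arc_mult G u w)"

lemma gen_laplacian_arc_weight:
  "gen_laplacian G \<sigma> u w = (if u = w then mvar u else of_int (arc_weight G \<sigma> u w))"
  by (simp add: gen_laplacian_def arc_weight_def)

lemma arc_weight_del_vert:
  assumes "u \<noteq> v" "w \<noteq> v"
  shows "arc_weight (pre_digraph.del_vert G v) \<sigma> u w = arc_weight G \<sigma> u w"
proof -
  have "arcs_from_to (pre_digraph.del_vert G v) u w = arcs_from_to G u w"
    using assms by (auto simp: arcs_from_to_def pre_digraph.del_vert_def)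
  then show ?thesis by (simp add: arc_weight_def pair_sign_def arc_mult_def)
qed

lemma verts_duplicate:
  assumes "v \<in> verts G"
  shows "verts (duplicate m G v) = dup_verts (verts G) v m"
proof -
  have "(v, c) \<in> (\<lambda>c. (v, c)) ` {1..m} \<longleftrightarrow> 0 < c \<and> c \<le> m" for c by auto
  then show ?thesis
    using assms by (auto simp: duplicate_def dup_verts_def split: if_splits)
qed

lemma arcs_from_to_duplicate_copies: "arcs_from_to (duplicate m G v) (v, c) (v, c') = {}"
  by (auto simp: arcs_from_to_def duplicate_def)

text \<open>As \<open>u\<close> and \<open>w\<close> differ, at most one end is a copy of
  \<open>v\<close>, and its index is the second component of the duplicated arcs. Tagging arcs with
  this index is a bijection that preserves signs.\<close>

lemma arc_weight_duplicate:
  assumes "(u, c) \<in> dup_verts V v m" "(w, c') \<in> dup_verts V v m" "u \<noteq> w"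
  shows "arc_weight (duplicate m G v) (\<sigma> \<circ> fst) (u, c) (w, c') = arc_weight G \<sigma> u w"
proof -
  have eq: "arcs_from_to (duplicate m G v) (u, c) (w, c') =
      (\<lambda>e. (e, if u = v then c else c')) ` arcs_from_to G u w"
    using assms by (auto simp: arcs_from_to_def duplicate_def dup_verts_def split: if_splits)
  have "arc_mult (duplicate m G v) (u, c) (w, c') = arc_mult G u w"
    unfolding arc_mult_def eq by (rule card_image) (auto intro: inj_onI)
  moreover have "(\<sigma> \<circ> fst) ` arcs_from_to (duplicate m G v) (u, c) (w, c') = \<sigma> ` arcs_from_to G u w"
    unfolding eq by (simp add: image_image)
  ultimately show ?thesis by (simp add: arc_weight_def pair_sign_def)
qed

lemma gen_laplacian_duplicate:
  assumes p: "p \<in> dup_verts V v m" and q: "q \<in> dup_verts V v m"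
  shows "gen_laplacian (duplicate m G v) (\<sigma> \<circ> fst) p q = blowup (arc_weight G \<sigma>) mvar p q"
proof -
  obtain u c w c' where pq: "p = (u, c)" "q = (w, c')" by (cases p; cases q)
  consider "p = q" | "p \<noteq> q" "u = w" | "u \<noteq> w" by blast
  then show ?thesis
  proof cases
    case 2
    \<comment> \<open>Only \<open>v\<close> has several copies, and these are joined by no
      arcs.\<close>
    then have "u = v" using p q pq by (auto simp: dup_verts_def split: if_splits)
    then have "arc_weight (duplicate m G v) (\<sigma> \<circ> fst) p q = 0"
      using 2 pq by (simp add: arc_weight_def arc_mult_def arcs_from_to_duplicate_copies)
    then show ?thesis using 2 pq by (simp add: gen_laplacian_arc_weight blowup_def)
  next
    case 3
    then show ?thesis
      using p q pq by (auto simp: gen_laplacian_arc_weight blowup_def arc_weight_duplicate)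
  qed (simp add: gen_laplacian_arc_weight blowup_def)
qed

lemma blowup_closed:
  assumes "\<And>p. p \<in> U \<Longrightarrow> y p \<in> carrier (mpol_ring V)" "p \<in> U"
  shows "blowup W y p q \<in> carrier (mpol_ring V)"
  using assms(1)[OF assms(2)] by (auto simp: blowup_def intro: mpol_closed)

lemma (in comm_ring_hom) hom_blowup: "hom (blowup W y p q) = blowup W (\<lambda>p. hom (y p)) p q"
  by (simp add: blowup_def hom_distribs)

lemma gen_laplacian_closed:
  "u \<in> V \<Longrightarrow> gen_laplacian G \<sigma> u w \<in> carrier (mpol_ring V)"
  unfolding gen_laplacian_arc_weight by (auto intro: mpol_closed)

lemma laplacian_minors_closed: "minors V (gen_laplacian G \<sigma>) i \<subseteq> carrier (mpol_ring V)"
  by (rule minors_closed) (rule gen_laplacian_closed)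

section \<open>Trivial critical ideals and the algebraic co-rank\<close>

lemma ideal_critical_ideal: "ideal (critical_ideal G \<sigma> i) (mpol_ring (verts G))"
  unfolding critical_ideal_def by (rule mpol_genideal_ideal[OF laplacian_minors_closed])

lemma critical_ideal_eq_unit_iff:
  "(critical_ideal G \<sigma> i :: ('v, 'a::comm_ring_1) mpol set) = Idl\<^bsub>mpol_ring (verts G)\<^esub> {1} \<longleftrightarrow>
    1 \<in> (critical_ideal G \<sigma> i :: ('v, 'a) mpol set)"
proof -
  have *: "Idl\<^bsub>mpol_ring (verts G)\<^esub> {1} = (carrier (mpol_ring (verts G)) :: ('v, 'a) mpol set)"
    using ring.genideal_one[OF mpol_ring] by simp
  show ?thesis
    using ideal.one_imp_carrier[OF ideal_critical_ideal[of G \<sigma> i, where ?'b = 'a]] mpol_one_closed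
    unfolding * by auto
qed

lemma critical_ideal_eq_0:
  assumes "finite (verts G)" "i > card (verts G)"
  shows "critical_ideal G \<sigma> i = ({0} :: ('v, 'a::comm_ring_1) mpol set)"
proof -
  have "minors (verts G) A i = {}" for A :: "'v \<Rightarrow> 'v \<Rightarrow> ('v, 'a) mpol"
    using assms(2) card_mono[OF assms(1)] by (auto elim!: minorsE) (metis distinct_card not_le)
  then have "critical_ideal G \<sigma> i \<subseteq> ({0} :: ('v, 'a) mpol set)"
    unfolding critical_ideal_def by (intro mpol_genideal_minimal mpol_idealI) (auto simp: mpol_closed)
  then show ?thesis using mpol_idealD(1)[OF ideal_critical_ideal] by blast
qed

text \<open>The maximum in \<open>algebraic_corank\<close> is attained: size 0 qualifies because the
  empty minor is 1, and sizes above the number of vertices yield the zero ideal, so the set is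
  finite.\<close>

lemma
  assumes "finite (verts G)"
  shows one_mem_critical_ideal_corank:
      "1 \<in> (critical_ideal G \<sigma> (algebraic_corank TYPE('a::comm_ring_1) G \<sigma>) :: ('v, 'a) mpol set)"
    and le_algebraic_corank:
      "1 \<in> (critical_ideal G \<sigma> i :: ('v, 'a) mpol set) \<Longrightarrow> i \<le> algebraic_corank TYPE('a) G \<sigma>"
proof -
  let ?I = "{i. 1 \<in> (critical_ideal G \<sigma> i :: ('v, 'a) mpol set)}"
  have corank: "algebraic_corank TYPE('a) G \<sigma> = Max ?I"
    unfolding algebraic_corank_def critical_ideal_eq_unit_iff ..
  have "i \<le> card (verts G)" if "i \<in> ?I" for i
  proof (rule ccontr)
    assume "\<not> i \<le> card (verts G)"
    then have "critical_ideal G \<sigma> i = ({0} :: ('v, 'a) mpol set)"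
      using assms by (intro critical_ideal_eq_0) auto
    with that show False by auto
  qed
  then have fin: "finite ?I" by (meson finite_nat_set_iff_bounded_le)
  have "list_minor (gen_laplacian G \<sigma>) [] [] \<in> (minors (verts G) (gen_laplacian G \<sigma>) 0 :: ('v, 'a) mpol set)"
    by (rule minorsI) auto
  then have "list_minor (gen_laplacian G \<sigma>) [] [] \<in> (critical_ideal G \<sigma> 0 :: ('v, 'a) mpol set)"
    unfolding critical_ideal_def by (rule subsetD[OF mpol_genideal_self[OF laplacian_minors_closed]])
  then have "0 \<in> ?I"
    by (simp add: list_minor_def det_dim_zero)
  then show "1 \<in> (critical_ideal G \<sigma> (algebraic_corank TYPE('a) G \<sigma>) :: ('v, 'a) mpol set)"
    unfolding corank using Max_in[OF fin] by blast
  show "1 \<in> (critical_ideal G \<sigma> i :: ('v, 'a) mpol set) \<Longrightarrow> i \<le> algebraic_corank TYPE('a) G \<sigma>"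
    unfolding corank using fin by (intro Max_ge) auto
qed

section \<open>The Laplacian of the graph at \<open>x_v = 0\<close>\<close>

text \<open>For \<open>W = arc_weight G \<sigma>\<close> this is \<open>L(G, X)\<close> at
  \<open>x_v = 0\<close>, written in the variables of a duplication. No variable of a copy of
  \<open>v\<close> occurs in it, so it is the same for every number of copies.\<close>

definition laplacian_at_zero ::
    "('v \<Rightarrow> 'v \<Rightarrow> int) \<Rightarrow> 'v \<Rightarrow> 'v \<Rightarrow> 'v \<Rightarrow> ('v \<times> nat, 'a::comm_ring_1) mpol" where
  "laplacian_at_zero W v u w = blowup W (\<lambda>p. if fst p = v then 0 else mvar p) (u, 0) (w, 0)"

lemma dup_verts_base: "u \<in> V \<Longrightarrow> (u, 0) \<in> dup_verts V v m"
  by (simp add: dup_verts_def)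

lemma laplacian_at_zero_closed:
  "u \<in> V \<Longrightarrow> laplacian_at_zero W v u w \<in> carrier (mpol_ring (dup_verts V v m))"
  unfolding laplacian_at_zero_def
  by (rule blowup_closed[of "dup_verts V v m"]) (auto intro: mpol_closed dup_verts_base)

lemma minors_laplacian_at_zero_closed:
  "minors V (laplacian_at_zero W v) i \<subseteq> carrier (mpol_ring (dup_verts V v m))"
  by (rule minors_closed) (rule laplacian_at_zero_closed)

lemma minors_duplicate_closed:
  "minors (dup_verts V v m) (blowup W mvar) i \<subseteq> carrier (mpol_ring (dup_verts V v m))"
  by (rule minors_closed) (auto intro!: blowup_closed[of "dup_verts V v m"] mpol_closed)

lemma critical_ideal_duplicate:
  assumes "v \<in> verts G"
  shows "critical_ideal (duplicate m G v) (\<sigma> \<circ> fst) i = Idl\<^bsub>mpol_ring (dup_verts (verts G) v m)\<^esub>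
    (minors (dup_verts (verts G) v m) (blowup (arc_weight G \<sigma>) mvar) i)"
  unfolding critical_ideal_def verts_duplicate[OF assms]
  by (rule arg_cong[OF minors_cong]) (rule gen_laplacian_duplicate)

text \<open>A substitution maps minors to minors, and the images of the generators generate the
  extended ideal.\<close>

lemma ideal_at_zero_critical_ideal:
  assumes "v \<in> verts G"
  shows "ideal_at_zero m G v (critical_ideal G \<sigma> i) =
    Idl\<^bsub>mpol_ring (dup_verts (verts G) v m)\<^esub> (minors (verts G) (laplacian_at_zero (arc_weight G \<sigma>) v) i)"
proof -
  define f :: "'a \<Rightarrow> ('a \<times> nat, 'c) mpol" where "f u = (if u = v then 0 else mvar (u, 0))" for u
  interpret comm_ring_hom "mpol_subst f" by (rule mpol_subst_hom)
  have "mpol_subst f ` minors (verts G) (gen_laplacian G \<sigma>) i =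
      minors (verts G) (laplacian_at_zero (arc_weight G \<sigma>) v) i"
    unfolding hom_minors
    by (rule minors_cong) (auto simp: gen_laplacian_arc_weight laplacian_at_zero_def blowup_def f_def hom_distribs)
  moreover have "Idl\<^bsub>mpol_ring (dup_verts (verts G) v m)\<^esub> (mpol_subst f ` critical_ideal G \<sigma> i) =
      Idl\<^bsub>mpol_ring (dup_verts (verts G) v m)\<^esub> (mpol_subst f ` minors (verts G) (gen_laplacian G \<sigma>) i)"
    unfolding critical_ideal_def
    by (rule mpol_genideal_image[OF mpol_subst_hom mpol_subst_closed laplacian_minors_closed])
      (auto simp: f_def intro: mpol_closed dup_verts_base)
  ultimately show ?thesis
    by (simp add: ideal_at_zero_def verts_duplicate[OF assms] f_def[abs_def])
qed

text \<open>Setting every copy variable to zero fixes 1 and maps each minor of the duplication to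
  zero or to a minor of \<open>laplacian_at_zero\<close>. No copy variables remain, so the number of
  copies may change from \<open>m\<close> to \<open>m'\<close>.\<close>

lemma one_mem_ideal_at_zero:
  assumes "1 \<in> Idl\<^bsub>mpol_ring (dup_verts V v m)\<^esub>
    (minors (dup_verts V v m) (blowup W mvar) i :: ('v \<times> nat, 'a::comm_ring_1) mpol set)"
  shows "1 \<in> Idl\<^bsub>mpol_ring (dup_verts V v m')\<^esub>
    (minors V (laplacian_at_zero W v) i :: ('v \<times> nat, 'a) mpol set)"
proof -
  define y :: "'v \<times> nat \<Rightarrow> ('v \<times> nat, 'a) mpol" where "y p = (if fst p = v then 0 else mvar p)" for p
  let ?J = "Idl\<^bsub>mpol_ring (dup_verts V v m')\<^esub> (minors V (laplacian_at_zero W v) i)"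
  interpret comm_ring_hom "mpol_subst y" by (rule mpol_subst_hom)
  have J: "ideal ?J (mpol_ring (dup_verts V v m'))"
    by (rule mpol_genideal_ideal[OF minors_laplacian_at_zero_closed])
  have "1 * mpol_subst y 1 \<in> ?J"
  proof (rule mpol_genideal_image_mem[OF mpol_subst_hom mpol_subst_closed J minors_duplicate_closed _ assms])
    fix p assume "p \<in> dup_verts V v m"
    then show "y p \<in> carrier (mpol_ring (dup_verts V v m'))"
      by (auto simp: y_def dup_verts_def intro: mpol_closed)
  next
    fix \<mu> assume "\<mu> \<in> (minors (dup_verts V v m) (blowup W mvar) i :: ('v \<times> nat, 'a) mpol set)"
    then have "mpol_subst y \<mu> \<in> mpol_subst y ` minors (dup_verts V v m) (blowup W mvar) i"
      by (rule imageI)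
    then have "mpol_subst y \<mu> \<in> minors (dup_verts V v m) (blowup W y) i"
      by (simp add: hom_minors hom_blowup)
    from minors_blowup_zero[OF this] have "mpol_subst y \<mu> = 0 \<or>
        mpol_subst y \<mu> \<in> minors V (laplacian_at_zero W v) i"
      by (simp add: y_def[abs_def] laplacian_at_zero_def[abs_def])
    then show "1 * mpol_subst y \<mu> \<in> ?J"
      using mpol_idealD(1)[OF J] subsetD[OF mpol_genideal_self[OF minors_laplacian_at_zero_closed]]
      by (elim disjE) simp_all
  qed
  then show ?thesis by (simp add: hom_one)
qed

text \<open>The vertex \<open>v\<close> is realized by the copy \<open>c\<close> among the rows and
  by \<open>c'\<close> among the columns. Both avoid \<open>S\<close>, so the copies in
  \<open>S\<close> can be added to rows and columns alike and then pulled out.\<close>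

lemma copy_product_mem:
  fixes J :: "('v \<times> nat, 'a::comm_ring_1) mpol set"
  assumes J: "\<And>a b. a \<in> J \<Longrightarrow> b \<in> J \<Longrightarrow> a - b \<in> J"
      "minors (dup_verts V v m) (blowup W mvar) (card S + length rs) \<subseteq> J"
    and S: "S \<subseteq> {0..m}" and "v \<in> V"
    and "distinct rs" "distinct cs" "length cs = length rs" "set rs \<subseteq> V" "set cs \<subseteq> V"
    and c: "c \<in> {0..m} - S" "c' \<in> {0..m} - S" "c \<noteq> c' \<or> v \<notin> set rs \<and> v \<notin> set cs"
  shows "(\<Prod>c\<in>S. mvar (v, c)) * list_minor (laplacian_at_zero W v) rs cs \<in> J"
proof -
  have "finite S" using S finite_subset by auto
  define ys where "ys = map (Pair v) (sorted_list_of_set S)"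
  have ys: "distinct ys" "set ys = Pair v ` S" "length ys = card S"
    using \<open>finite S\<close> by (auto simp: ys_def distinct_map intro: inj_onI)
  have fst_ys: "fst s = v" if "s \<in> set ys" for s using that ys(2) by auto
  have prod_ys: "(\<Prod>c\<in>S. mvar (v, c)) = (prod mvar (set ys) :: ('v \<times> nat, 'a) mpol)"
    unfolding ys by (subst prod.reindex) (auto intro: inj_onI)
  define f where "f c u = (u, if u = v then c else 0)" for c :: nat and u
  define R C where "R = map (f c) rs" and "C = map (f c') cs"
  have inj: "inj_on (f c) A" for c A by (auto simp: f_def intro: inj_onI)
  \<comment> \<open>The zero in row and column \<open>v\<close> arises as the entry between two
    different copies; if \<open>v\<close> occurs in neither list, \<open>c = c'\<close> does no
    harm.\<close>
  have minor: "list_minor (laplacian_at_zero W v) rs cs =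
      (list_minor (blowup W mvar) R C :: ('v \<times> nat, 'a) mpol)"
    unfolding R_def C_def list_minor_map[OF \<open>length cs = length rs\<close>]
    by (rule list_minor_cong_set[OF \<open>length cs = length rs\<close>])
      (use c(3) in \<open>auto simp: laplacian_at_zero_def blowup_def f_def\<close>)
  have RC: "length C = length R" "length R = length rs" "distinct R" "distinct C"
    "set R \<subseteq> dup_verts V v m" "set C \<subseteq> dup_verts V v m" "set ys \<subseteq> dup_verts V v m"
    "distinct (ys @ R)" "distinct (ys @ C)"
    using assms ys inj by (auto simp: R_def C_def distinct_map f_def dup_verts_def)
  have mem: "list_minor (blowup W mvar) (ys @ R) (ys @ C) \<in> J"
    by (rule subsetD[OF J(2)], rule minorsI) (use RC ys in auto)
  \<comment> \<open>In the first two cases a copy that is only a row, or only a column, pulls out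
    all of \<open>S\<close> at once. In the third, \<open>c\<close> is the spare copy for
    \<open>blowup_pull_mem\<close>.\<close>
  consider "v \<in> set rs" "c \<noteq> c'" | "v \<notin> set rs" "v \<in> set cs" | "v \<notin> set rs" "v \<notin> set cs"
    using c(3) by blast
  then have "prod mvar (set ys) * list_minor (blowup W mvar) R C \<in> J"
  proof cases
    case 1
    then have "(v, c) \<in> set R" "(v, c) \<notin> set C"
      by (auto simp: R_def C_def f_def image_iff intro!: bexI[of _ v])
    then have "list_minor (blowup W mvar) (ys @ R) (ys @ C) =
        (prod mvar (set ys) * list_minor (blowup W mvar) R C :: ('v \<times> nat, 'a) mpol)"
      by (intro blowup_pull_rows[of _ _ _ "(v, c)"]) (use RC fst_ys in auto)
    with mem show ?thesis by simp
  next
    case 2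
    then have "(v, c') \<in> set C" "(v, c') \<notin> set R"
      by (auto simp: R_def C_def f_def image_iff intro!: bexI[of _ v])
    then have "list_minor (blowup W mvar) (ys @ R) (ys @ C) =
        (prod mvar (set ys) * list_minor (blowup W mvar) R C :: ('v \<times> nat, 'a) mpol)"
      by (intro blowup_pull_cols[of _ _ _ "(v, c')"]) (use RC fst_ys in auto)
    with mem show ?thesis by simp
  next
    case 3
    then have "(v, c) \<notin> set R \<union> set C" "(v, c) \<notin> set ys"
      using c(1) ys by (auto simp: R_def C_def f_def)
    moreover have "(v, c) \<in> dup_verts V v m" using c(1) \<open>v \<in> V\<close> by (simp add: dup_verts_def)
    ultimately show ?thesis
      by (intro blowup_pull_mem[of J "dup_verts V v m" _ _ _ _ _ "(v, c)"])
        (use J RC ys fst_ys in auto)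
  qed
  then show ?thesis by (simp add: prod_ys minor)
qed

lemma copy_productsI: "S \<subseteq> {0..m} \<Longrightarrow> card S = l \<Longrightarrow> (\<Prod>c\<in>S. mvar (v, c)) \<in> copy_products v m l"
  by (auto simp: copy_products_def)

lemma copy_products_closed:
  assumes "v \<in> V"
  shows "copy_products v m l \<subseteq> carrier (mpol_ring (dup_verts V v m))"
  using assms by (auto simp: copy_products_def dup_verts_def intro!: mpol_prod_closed mpol_mvar_closed)

section \<open>The equality of ideals\<close>

text \<open>The claimed equality for arbitrary weights. The assumption \<open>one\<close> makes
  products of more than \<open>k\<close> variables redundant; \<open>full\<close> settles the
  products with \<open>card S = k = m\<close>, where only one copy lies outside
  \<open>S\<close>.\<close>

lemma critical_ideal_duplicate_eq:
  fixes W :: "'v \<Rightarrow> 'v \<Rightarrow> int" and V :: "'v set" and v :: 'v and m :: nat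
  defines "D \<equiv> dup_verts V v m"
  defines "R \<equiv> (mpol_ring D :: ('v \<times> nat, 'a::comm_ring_1) mpol ring)"
  assumes v: "v \<in> V" and "k \<le> m"
    and one: "1 \<in> Idl\<^bsub>R\<^esub> (minors V (laplacian_at_zero W v) g)"
    and full: "\<And>S. k = m \<Longrightarrow> S \<subseteq> {0..m} \<Longrightarrow> card S = k \<Longrightarrow>
      (\<Prod>c\<in>S. mvar (v, c)) \<in> Idl\<^bsub>R\<^esub> (minors D (blowup W mvar) (g + k))"
  shows "Idl\<^bsub>R\<^esub> (minors D (blowup W mvar) (g + k)) =
    Idl\<^bsub>R\<^esub> (\<Union>l\<in>{0..k}. copy_products v m l <#>\<^bsub>R\<^esub> Idl\<^bsub>R\<^esub> (minors V (laplacian_at_zero W v) (g + k - l)))"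
    (is "?L = Idl\<^bsub>R\<^esub> ?U")
proof
  let ?M = "\<lambda>i. minors V (laplacian_at_zero W v :: 'v \<Rightarrow> 'v \<Rightarrow> ('v \<times> nat, 'a) mpol) i"
  have M: "?M i \<subseteq> carrier R" for i
    unfolding R_def D_def by (rule minors_laplacian_at_zero_closed)
  have F: "minors D (blowup W mvar) i \<subseteq> carrier R" for i
    unfolding R_def D_def by (rule minors_duplicate_closed)
  have idealM: "ideal (Idl\<^bsub>R\<^esub> (?M i)) R" for i
    using mpol_genideal_ideal M unfolding R_def by blast
  have L: "ideal ?L R"
    using mpol_genideal_ideal F unfolding R_def by blast
  have copy_product_in: "(\<Prod>c\<in>S. mvar (v, c)) \<in> (copy_products v m (card S) :: ('v \<times> nat, 'a) mpol set)"
    if "S \<subseteq> {0..m}" for S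
    by (rule copy_productsI[OF that refl])
  have copy_product_closed: "(\<Prod>c\<in>S. mvar (v, c)) \<in> carrier R" if "S \<subseteq> {0..m}" for S
    using copy_product_in[OF that] copy_products_closed[OF v, of m "card S"] unfolding R_def D_def by blast
  have U_iff: "p \<in> ?U \<longleftrightarrow> (\<exists>S q. S \<subseteq> {0..m} \<and> card S \<le> k \<and>
      q \<in> Idl\<^bsub>R\<^esub> (?M (g + k - card S)) \<and> p = (\<Prod>c\<in>S. mvar (v, c)) * q)" for p
  proof
    assume "p \<in> ?U"
    then obtain l a q where l: "l \<le> k" and a: "a \<in> copy_products v m l"
      and q: "q \<in> Idl\<^bsub>R\<^esub> (?M (g + k - l))" and p: "p = a * q"
      unfolding set_mult_def R_def by auto
    from a obtain S where "S \<subseteq> {0..m}" "card S = l" "a = (\<Prod>c\<in>S. mvar (v, c))"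
      unfolding copy_products_def by blast
    with l q p show "\<exists>S q. S \<subseteq> {0..m} \<and> card S \<le> k \<and>
      q \<in> Idl\<^bsub>R\<^esub> (?M (g + k - card S)) \<and> p = (\<Prod>c\<in>S. mvar (v, c)) * q" by blast
  next
    assume "\<exists>S q. S \<subseteq> {0..m} \<and> card S \<le> k \<and>
      q \<in> Idl\<^bsub>R\<^esub> (?M (g + k - card S)) \<and> p = (\<Prod>c\<in>S. mvar (v, c)) * q"
    then obtain S q where S: "S \<subseteq> {0..m}" "card S \<le> k" "q \<in> Idl\<^bsub>R\<^esub> (?M (g + k - card S))"
      and p: "p = (\<Prod>c\<in>S. mvar (v, c)) * q" by blast
    have "p \<in> copy_products v m (card S) <#>\<^bsub>R\<^esub> Idl\<^bsub>R\<^esub> (?M (g + k - card S))"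
      unfolding p set_mult_def R_def mpol_ring_simps
      using S(3)[unfolded R_def] copy_product_in[OF S(1)] by blast
    then show "p \<in> ?U" using S(2) by auto
  qed
  have U: "?U \<subseteq> carrier R"
  proof
    fix p assume "p \<in> ?U"
    then obtain S q where "S \<subseteq> {0..m}" "q \<in> Idl\<^bsub>R\<^esub> (?M (g + k - card S))"
      "p = (\<Prod>c\<in>S. mvar (v, c)) * q" unfolding U_iff by blast
    then show "p \<in> carrier R"
      using copy_product_closed[unfolded R_def] mpol_idealD(6)[OF idealM[unfolded R_def]]
      unfolding R_def by (auto intro!: mpol_mult_closed)
  qed
  have UI: "ideal (Idl\<^bsub>R\<^esub> ?U) R" "?U \<subseteq> Idl\<^bsub>R\<^esub> ?U"
    using mpol_genideal_ideal mpol_genideal_self U unfolding R_def by blast+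
  have U_memI: "(\<Prod>c\<in>S. mvar (v, c)) * q \<in> Idl\<^bsub>R\<^esub> ?U"
    if "S \<subseteq> {0..m}" "card S \<le> k" "q \<in> Idl\<^bsub>R\<^esub> (?M (g + k - card S))" for S q
    by (rule subsetD[OF UI(2)], subst U_iff) (use that in blast)

  show "?L \<subseteq> Idl\<^bsub>R\<^esub> ?U"
    unfolding R_def
  proof (rule mpol_genideal_minimal[OF UI(1)[unfolded R_def]], fold R_def, rule subsetI)
    fix \<mu> :: "('v \<times> nat, 'a) mpol"
    assume \<mu>: "\<mu> \<in> minors D (blowup W mvar) (g + k)"
    \<comment> \<open>Every copy has an index in \<open>{0..m}\<close>, so nothing is set to zero
      yet; this is where the induction of \<open>minors_blowup_mem\<close> starts.\<close>
    have eq: "minors (dup_verts V v m) (blowup W mvar) (g + k) = minors (dup_verts V v m) (blowup W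
        (\<lambda>p. if fst p = v \<and> snd p \<notin> {0..m} then 0 else mvar p :: ('v \<times> nat, 'a) mpol)) (g + k)"
      by (rule minors_cong) (auto simp: blowup_def dup_verts_def)
    have "1 * \<mu> \<in> Idl\<^bsub>R\<^esub> ?U"
    proof (rule minors_blowup_mem[OF _ _ _ finite_atLeastAtMost _ \<mu>[unfolded D_def, unfolded eq]])
      fix S and \<delta> :: "('v \<times> nat, 'a) mpol"
      assume S: "S \<subseteq> {0..m}" and "card S \<le> g + k"
        and "\<delta> \<in> minors V (\<lambda>u w. blowup W (\<lambda>p. if fst p = v then 0 else mvar p) (u, 0) (w, 0)) (g + k - card S)"
      then have \<delta>: "\<delta> \<in> ?M (g + k - card S)" by (simp add: laplacian_at_zero_def[abs_def])
      then have \<delta>': "\<delta> \<in> Idl\<^bsub>R\<^esub> (?M (g + k - card S))" "\<delta> \<in> carrier R"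
        using mpol_genideal_self M unfolding R_def by blast+
      show "1 * (\<Prod>c\<in>S. mvar (v, c)) * \<delta> \<in> Idl\<^bsub>R\<^esub> ?U"
      proof (cases "card S \<le> k")
        case True
        with U_memI[OF S _ \<delta>'(1)] show ?thesis by simp
      next
        case False
        \<comment> \<open>A subproduct of exactly \<open>k\<close> variables lies in the ideal, as
          it is paired with the ideal for size \<open>g\<close>, which contains 1. The remaining
          variables and \<open>\<delta>\<close> form a ring multiple.\<close>
        then obtain T where T: "T \<subseteq> S" "card T = k"
          using obtain_subset_with_card_n[of k S] by auto
        have "finite S" using S finite_subset by blast
        have "(\<Prod>c\<in>T. mvar (v, c)) * 1 \<in> Idl\<^bsub>R\<^esub> ?U"
          by (rule U_memI) (use S T one in auto)
        moreover have "(\<Prod>c\<in>S - T. mvar (v, c)) * \<delta> \<in> carrier R"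
          using \<delta>'(2) copy_product_closed[of "S - T"] S unfolding R_def
          by (auto intro!: mpol_mult_closed)
        ultimately have "((\<Prod>c\<in>S - T. mvar (v, c)) * \<delta>) * (\<Prod>c\<in>T. mvar (v, c)) \<in> Idl\<^bsub>R\<^esub> ?U"
          using mpol_idealD(5)[OF UI(1)[unfolded R_def]] unfolding R_def by simp
        then show ?thesis
          using prod.subset_diff[OF T(1) \<open>finite S\<close>, of "\<lambda>c. mvar (v, c) :: ('v \<times> nat, 'a) mpol"]
          by (simp add: ac_simps)
      qed
    qed (use mpol_idealD[OF UI(1)[unfolded R_def]] in \<open>simp_all add: R_def\<close>)
    then show "\<mu> \<in> Idl\<^bsub>R\<^esub> ?U" by simp
  qed

  have low: "(\<Prod>c\<in>S. mvar (v, c)) * \<delta> \<in> ?L"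
    if S: "S \<subseteq> {0..m}" "card S \<le> k" "card S < m" and \<delta>: "\<delta> \<in> ?M (g + k - card S)" for S \<delta>
  proof -
    \<comment> \<open>There are \<open>m + 1\<close> copies, so at least two lie outside
      \<open>S\<close>: one for the row of \<open>v\<close> and one for its column.\<close>
    have "card ({0..m} - S) = Suc m - card S" using S(1) by (simp add: card_Diff_subset finite_subset)
    then have "2 \<le> card ({0..m} - S)" using S(3) by simp
    then obtain T where "T \<subseteq> {0..m} - S" "card T = 2"
      using obtain_subset_with_card_n by metis
    then obtain c c' where c: "c \<in> {0..m} - S" "c' \<in> {0..m} - S" "c \<noteq> c'"
      by (auto simp: card_2_iff)
    obtain rs cs where *: "\<delta> = list_minor (laplacian_at_zero W v) rs cs" "distinct rs" "distinct cs"
      "length rs = g + k - card S" "length cs = g + k - card S" "set rs \<subseteq> V" "set cs \<subseteq> V"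
      using \<delta> by (rule minorsE)
    have "card S + length rs = g + k" using * S by simp
    with mpol_genideal_self[OF F[unfolded R_def], of "g + k"]
    have sub: "minors (dup_verts V v m) (blowup W mvar) (card S + length rs) \<subseteq> ?L"
      unfolding R_def D_def by simp
    show ?thesis
      unfolding *(1)
      by (rule copy_product_mem[OF _ sub S(1) v, where c = c and c' = c'])
        (use * c mpol_idealD(4)[OF L[unfolded R_def]] in \<open>auto simp: R_def\<close>)
  qed

  show "Idl\<^bsub>R\<^esub> ?U \<subseteq> ?L"
    unfolding R_def
  proof (rule mpol_genideal_minimal[OF L[unfolded R_def]], fold R_def, rule subsetI)
    fix p assume "p \<in> ?U"
    then obtain S q where S: "S \<subseteq> {0..m}" "card S \<le> k" and q: "q \<in> Idl\<^bsub>R\<^esub> (?M (g + k - card S))"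
      and p: "p = (\<Prod>c\<in>S. mvar (v, c)) * q" unfolding U_iff by blast
    show "p \<in> ?L"
    proof (cases "card S < m")
      case True
      show ?thesis
        unfolding p R_def
        by (rule mpol_genideal_scale_mem[OF L[unfolded R_def] M[unfolded R_def] _ q[unfolded R_def]])
          (use low[OF S True] in \<open>simp add: R_def\<close>)
    next
      case False
      \<comment> \<open>The chain \<open>m \<le> card S \<le> k \<le> m\<close> collapses;
        \<open>full\<close> then yields the bare product, which \<open>q\<close> merely
        multiplies.\<close>
      then have "k = m" "card S = k" using S \<open>k \<le> m\<close> by auto
      from full[OF this(1) S(1) this(2)] have "q * (\<Prod>c\<in>S. mvar (v, c)) \<in> ?L"
        using q mpol_idealD(5)[OF L[unfolded R_def]] mpol_idealD(6)[OF idealM[unfolded R_def]]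
        unfolding R_def by blast
      then show ?thesis by (simp add: p mult.commute)
    qed
  qed
qed

section \<open>Comparison with the deletion of the vertex\<close>

lemma minors_del_vert:
  "minors (verts G - {v}) (gen_laplacian (pre_digraph.del_vert G v) \<sigma>) i =
   minors (verts G - {v}) (gen_laplacian G \<sigma>) i"
  by (rule minors_cong) (auto simp: gen_laplacian_arc_weight arc_weight_del_vert)

lemma critical_ideal_del_vert:
  "critical_ideal (pre_digraph.del_vert G v) \<sigma> i =
    Idl\<^bsub>mpol_ring (verts G - {v})\<^esub> (minors (verts G - {v}) (gen_laplacian G \<sigma>) i)"
  by (simp add: critical_ideal_def pre_digraph.verts_del_vert minors_del_vert)

text \<open>Minors of \<open>G - v\<close> involve no row or column of \<open>v\<close>, so a single
  copy outside \<open>S\<close> is enough; since these minors generate 1, the bare product is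
  obtained. It exists because at most \<open>m\<close> of the \<open>m + 1\<close> copies are in
  \<open>S\<close>.\<close>

lemma copy_product_mem_of_del_vert:
  fixes G :: "('v, 'e) pre_digraph" and S :: "nat set"
  assumes v: "v \<in> verts G" and S: "S \<subseteq> {0..m}" "card S \<le> m"
    and one: "1 \<in> (critical_ideal (pre_digraph.del_vert G v) \<sigma> i :: ('v, 'a::comm_ring_1) mpol set)"
  shows "(\<Prod>c\<in>S. mvar (v, c)) \<in>
    (critical_ideal (duplicate m G v) (\<sigma> \<circ> fst) (i + card S) :: ('v \<times> nat, 'a) mpol set)"
    (is "?z \<in> ?J")
proof -
  let ?W = "arc_weight G \<sigma>" and ?D = "dup_verts (verts G) v m"
  let ?f = "\<lambda>u. mvar (u, 0) :: ('v \<times> nat, 'a) mpol"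
  interpret comm_ring_hom "mpol_subst ?f" by (rule mpol_subst_hom)
  have J: "ideal ?J (mpol_ring ?D)"
    using ideal_critical_ideal[of "duplicate m G v"] by (simp add: verts_duplicate[OF v])
  have sub: "minors ?D (blowup ?W mvar) (i + card S) \<subseteq> ?J"
    unfolding critical_ideal_duplicate[OF v] by (rule mpol_genideal_self[OF minors_duplicate_closed])
  have "card S < card {0..m}" using S by simp
  then obtain c where c: "c \<in> {0..m} - S"
    using S(1) by (metis Diff_eq_empty_iff ex_in_conv less_irrefl subset_antisym)
  have "?z * mpol_subst ?f 1 \<in> ?J"
  proof (rule mpol_genideal_image_mem[OF mpol_subst_hom mpol_subst_closed J laplacian_minors_closed _
        one[unfolded critical_ideal_del_vert]])
    fix u assume "u \<in> verts G - {v}"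
    then show "?f u \<in> carrier (mpol_ring ?D)" by (intro mpol_closed dup_verts_base) auto
  next
    fix \<mu> :: "('v, 'a) mpol"
    assume "\<mu> \<in> minors (verts G - {v}) (gen_laplacian G \<sigma>) i"
    then obtain rs cs where *: "\<mu> = list_minor (gen_laplacian G \<sigma>) rs cs" "distinct rs" "distinct cs"
      "length rs = i" "length cs = i" "set rs \<subseteq> verts G - {v}" "set cs \<subseteq> verts G - {v}"
      by (rule minorsE)
    have "mpol_subst ?f \<mu> = list_minor (laplacian_at_zero ?W v) rs cs"
      unfolding *(1) hom_list_minor
      by (rule list_minor_cong_set)
        (use * in \<open>auto simp: gen_laplacian_arc_weight laplacian_at_zero_def blowup_def hom_distribs\<close>)
    moreover have "?z * list_minor (laplacian_at_zero ?W v) rs cs \<in> ?J"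
      \<comment> \<open>The choice \<open>c' = c\<close> is admissible, as \<open>v\<close> is in
        neither list.\<close>
      by (rule copy_product_mem[where V = "verts G" and m = m and c = c and c' = c])
        (use * c S v sub mpol_idealD(4)[OF J] in \<open>auto simp: add.commute\<close>)
    ultimately show "?z * mpol_subst ?f \<mu> \<in> ?J" by simp
  qed
  then show ?thesis by (simp add: hom_one)
qed

text \<open>Setting the copy variables to zero leads into the polynomials over
  \<open>verts G - {v}\<close>. There the minors of the duplication become zero or minors of size
  \<open>i + 2\<close> of \<open>L(G, X)\<close> at \<open>x_v = 0\<close>, and
  \<open>minors_subset_ideal\<close> reduces these to minors of \<open>G - v\<close> of size
  \<open>i\<close>.\<close>

lemma one_mem_critical_ideal_del_vert:
  fixes G :: "('v, 'e) pre_digraph"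
  assumes v: "v \<in> verts G"
    and one: "1 \<in> (critical_ideal (duplicate m G v) (\<sigma> \<circ> fst) (i + 2) :: ('v \<times> nat, 'a::comm_ring_1) mpol set)"
  shows "1 \<in> (critical_ideal (pre_digraph.del_vert G v) \<sigma> i :: ('v, 'a) mpol set)"
proof -
  let ?W = "arc_weight G \<sigma>" and ?D = "dup_verts (verts G) v m" and ?U = "verts G - {v}"
  let ?J = "critical_ideal (pre_digraph.del_vert G v) \<sigma> i :: ('v, 'a) mpol set"
  define y :: "'v \<times> nat \<Rightarrow> ('v, 'a) mpol" where "y p = (if fst p = v then 0 else mvar (fst p))" for p
  define A where "A u w = blowup ?W y (u, 0) (w, 0)" for u w
  interpret comm_ring_hom "mpol_subst y" by (rule mpol_subst_hom)
  have J: "ideal ?J (mpol_ring ?U)"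
    using ideal_critical_ideal[of "pre_digraph.del_vert G v"] by (simp add: pre_digraph.verts_del_vert)
  have y_closed: "y p \<in> carrier (mpol_ring ?U)" if "fst p \<in> verts G" for p
    using that by (auto simp: y_def intro: mpol_closed)
  have "minors ?U A i = minors ?U (gen_laplacian G \<sigma>) i"
    by (rule minors_cong) (auto simp: A_def blowup_def y_def gen_laplacian_arc_weight)
  then have "minors ?U A i \<subseteq> ?J"
    using mpol_genideal_self[OF laplacian_minors_closed] by (simp add: critical_ideal_del_vert)
  then have A: "minors (verts G) A (i + 2) \<subseteq> ?J"
    by (intro minors_subset_ideal[OF J])
      (auto simp: A_def intro!: blowup_closed[of "{p. fst p \<in> verts G}"] y_closed)
  have "1 * mpol_subst y 1 \<in> ?J"
  proof (rule mpol_genideal_image_mem[OF mpol_subst_hom mpol_subst_closed J minors_duplicate_closed _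
        one[unfolded critical_ideal_duplicate[OF v]]])
    fix p assume "p \<in> ?D"
    then show "y p \<in> carrier (mpol_ring ?U)" by (intro y_closed) (simp add: dup_verts_def)
  next
    fix \<mu> :: "('v \<times> nat, 'a) mpol"
    assume "\<mu> \<in> minors ?D (blowup ?W mvar) (i + 2)"
    then have "mpol_subst y \<mu> \<in> mpol_subst y ` minors ?D (blowup ?W mvar) (i + 2)"
      by (rule imageI)
    then have "mpol_subst y \<mu> \<in> minors ?D (blowup ?W y) (i + 2)"
      by (simp add: hom_minors hom_blowup)
    from minors_blowup_zero[OF this] have "mpol_subst y \<mu> = 0 \<or> mpol_subst y \<mu> \<in> minors (verts G) A (i + 2)"
      by (simp add: y_def[abs_def] A_def[abs_def])
    then show "1 * mpol_subst y \<mu> \<in> ?J"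
      using mpol_idealD(1)[OF J] subsetD[OF A] by (elim disjE) simp_all
  qed
  then show ?thesis by (simp add: hom_one)
qed

section \<open>Bounds on the co-ranks and the equality for duplications\<close>

theorem theorem3p4:
  fixes G :: "('v, 'e) pre_digraph" and \<sigma> :: "'e \<Rightarrow> int" and v :: 'v
    and \<gamma>\<^sub>d \<gamma>\<^sub>v lam :: nat
  assumes PID: "principal_domain (ring_of_type_algebra :: 'a::idom ring)"
    and G: "signed_multidigraph G \<sigma>"
    and v: "v \<in> verts G"
    and \<gamma>\<^sub>d: "\<gamma>\<^sub>d = algebraic_corank TYPE('a) (duplicate 1 G v) (\<sigma> \<circ> fst)"
    and \<gamma>\<^sub>v: "\<gamma>\<^sub>v = algebraic_corank TYPE('a) (pre_digraph.del_vert G v) \<sigma>"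
    and lam: "lam = (if \<gamma>\<^sub>v = \<gamma>\<^sub>d then 0 else 1)"
    and corank_ge_2: "algebraic_corank TYPE('a) G \<sigma> \<ge> 2"
  shows "0 \<le> int \<gamma>\<^sub>d - int \<gamma>\<^sub>v \<and> int \<gamma>\<^sub>d - int \<gamma>\<^sub>v \<le> 2 \<and>
    (\<forall>k\<ge>1. \<forall>i\<ge>0.
      (critical_ideal (duplicate (k + lam + i) G v) (\<sigma> \<circ> fst) (\<gamma>\<^sub>d + k)
         :: ('v \<times> nat, 'a) mpol set) =
      Idl\<^bsub>mpol_ring (verts (duplicate (k + lam + i) G v))\<^esub>
        (\<Union>l\<in>{0..k}. copy_products v (k + lam + i) l
           <#>\<^bsub>mpol_ring (verts (duplicate (k + lam + i) G v))\<^esub>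
           ideal_at_zero (k + lam + i) G v (critical_ideal G \<sigma> (\<gamma>\<^sub>d + k - l))))"
proof -
  interpret signed_multidigraph G \<sigma> by (rule G)
  let ?W = "arc_weight G \<sigma>"
  have fin: "finite (verts (duplicate m G v))" "finite (verts (pre_digraph.del_vert G v))" for m
    by (simp_all add: duplicate_def pre_digraph.verts_del_vert)
  have one_d: "1 \<in> (critical_ideal (duplicate 1 G v) (\<sigma> \<circ> fst) \<gamma>\<^sub>d :: ('v \<times> nat, 'a) mpol set)"
    unfolding \<gamma>\<^sub>d by (rule one_mem_critical_ideal_corank[OF fin(1)])
  have one_v: "1 \<in> (critical_ideal (pre_digraph.del_vert G v) \<sigma> \<gamma>\<^sub>v :: ('v, 'a) mpol set)"
    unfolding \<gamma>\<^sub>v by (rule one_mem_critical_ideal_corank[OF fin(2)])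
  \<comment> \<open>The empty set of copies gives the empty product, which is 1.\<close>
  have "1 \<in> (critical_ideal (duplicate 1 G v) (\<sigma> \<circ> fst) \<gamma>\<^sub>v :: ('v \<times> nat, 'a) mpol set)"
    using copy_product_mem_of_del_vert[OF v _ _ one_v, of "{}" 1] by simp
  then have "\<gamma>\<^sub>v \<le> \<gamma>\<^sub>d"
    unfolding \<gamma>\<^sub>d by (rule le_algebraic_corank[OF fin(1)])
  moreover have "\<gamma>\<^sub>d \<le> \<gamma>\<^sub>v + 2"
  \<comment> \<open>Subtraction on naturals is truncated; below 2 the bound is immediate.\<close>
  proof (cases "\<gamma>\<^sub>d \<ge> 2")
    case True
    then have "\<gamma>\<^sub>d - 2 + 2 = \<gamma>\<^sub>d" by simp
    with one_d have "1 \<in> (critical_ideal (pre_digraph.del_vert G v) \<sigma> (\<gamma>\<^sub>d - 2) :: ('v, 'a) mpol set)"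
      by (intro one_mem_critical_ideal_del_vert[OF v, of 1]) (simp only:)
    then have "\<gamma>\<^sub>d - 2 \<le> \<gamma>\<^sub>v"
      unfolding \<gamma>\<^sub>v by (rule le_algebraic_corank[OF fin(2)])
    then show ?thesis by simp
  qed simp
  moreover have "(critical_ideal (duplicate m G v) (\<sigma> \<circ> fst) (\<gamma>\<^sub>d + k) :: ('v \<times> nat, 'a) mpol set) =
      Idl\<^bsub>mpol_ring (verts (duplicate m G v))\<^esub>
        (\<Union>l\<in>{0..k}. copy_products v m l <#>\<^bsub>mpol_ring (verts (duplicate m G v))\<^esub>
           ideal_at_zero m G v (critical_ideal G \<sigma> (\<gamma>\<^sub>d + k - l)))"
    if m: "m = k + lam + i" for m k i
    unfolding verts_duplicate[OF v] critical_ideal_duplicate[OF v] ideal_at_zero_critical_ideal[OF v]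
  proof (rule critical_ideal_duplicate_eq[OF v])
    show "k \<le> m" using m by simp
    show "1 \<in> Idl\<^bsub>mpol_ring (dup_verts (verts G) v m)\<^esub>
        (minors (verts G) (laplacian_at_zero ?W v) \<gamma>\<^sub>d :: ('v \<times> nat, 'a) mpol set)"
      using one_d unfolding critical_ideal_duplicate[OF v] by (rule one_mem_ideal_at_zero)
    fix S assume S: "k = m" "S \<subseteq> {0..m}" "card S = k"
    \<comment> \<open>Since \<open>m = k + lam + i\<close>, the equation \<open>k = m\<close> forces
      \<open>lam = 0\<close>. A trivial ideal of \<open>G - v\<close> is then available at size
      \<open>\<gamma>\<^sub>d\<close>.\<close>
    then have "\<gamma>\<^sub>v = \<gamma>\<^sub>d" using m lam by (simp split: if_splits)
    then show "(\<Prod>c\<in>S. mvar (v, c)) \<in> Idl\<^bsub>mpol_ring (dup_verts (verts G) v m)\<^esub>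
        (minors (dup_verts (verts G) v m) (blowup ?W mvar) (\<gamma>\<^sub>d + k) :: ('v \<times> nat, 'a) mpol set)"
      using copy_product_mem_of_del_vert[OF v S(2) _ one_v] S
      by (simp add: critical_ideal_duplicate[OF v])
  qed
  ultimately show ?thesis by auto
qed

end
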